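(* A measure with properties similar to those of the measure $P$ on $\mathcal{K}_0$ defined in the context exists on the space $\mathcal{K}$ of convex bodies. Namely, let $m(K):=\frac12(K+(-K))$, where the addition is the Minkowski sum of convex bodies. The mapping $m:\mathcal{K}\to\mathcal{K}_0$ is a continuous function on $\mathcal{K}$ and thus it defines a pullback measure $\mu$ on $\mathcal{K}$ by the rule $$\mu(H)=P(m(H)),\qquad\text{where } H=m^{-1}(H')\text{ for a Borel set } H'\subset\mathcal{K}_0.$$ The mapping $m$ has the following properties: (1) $m$ is surjective; (2) for any set $S\subset\mathcal{K}$ and any vector $t\in\mathbb{R}^n$, $m(S+t)=m(S)$; (3) for any $K\in\mathcal{K}$, $d(K)=d(m(K))$ and $w(K)=w(m(K))$, implying $\alpha_0(K)=\alpha_0(m(K))$. Hence the function $\alpha_0$ is well-defined on $\mathcal{K}$, and for any Borel set $B\subset[\frac12,1)$, $$\mu\left(\alpha_0^{-1}(B)\right)=P\left(m\left(\alpha_0^{-1}(B)\right)\right)=P\left((\alpha_0|_{\mathcal{K}_0})^{-1}(B)\right),$$ so the pushforward of $\mu$ by $\alpha_0$ has truncated normal distribution on the interval $[\frac12,1)$.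
   Context: $V=\mathbb{R}^n$ is a real $n$-dimensional Euclidean space with origin $O$ and unit ball $B_E$. $\mathcal{K}$ is the space of convex bodies of $V$ with the Hausdorff metric $\delta^h$, and $\mathcal{K}_0\subset\mathcal{K}$ is the subspace of convex bodies centrally symmetric about $O$ (the unit balls of norms on $V$). For a convex body $K$, $d(K)$ is its Euclidean diameter, $w(K)$ its (minimal) width, and $\alpha_0(K):=\frac{d(K)}{w(K)+d(K)}$ is its thinness. For a set $S$ of bodies, $S+t=\{K+t \mid K\in S\}$. $\mathcal{K}_0^1:=\{K\in\mathcal{K}_0 \mid \delta^h(K,B_E)=1\}$. $\Phi_4$ is the map $(K,\alpha)\mapsto\alpha K$, by which $\mathcal{K}_0$ is identified with $\mathcal{K}_0^1\times[0,\infty)$; for $K'=\alpha K$ with $K\in\mathcal{K}_0^1$ write $(\Phi_4^{-1}(K'))_2=\alpha$. The measure $P$ on $\mathcal{K}_0$: let $\sigma>0$, let $\nu_0^1$ be a probability measure on $\mathcal{K}_0^1$ whose pushforward by $\alpha_0$ has uniform distribution on $[\frac12,1)$, let $\nu$ be a probability measure on $(0,\infty)$, let $\nu_0$ be the pushforward of $\nu_0^1\otimes\nu$ by $\Phi_4$, and let $\Phi$ be the distribution function of the standard normal distribution. For $\nu_0$-measurable $\mathcal{A}\subset\mathcal{K}_0$, $$P(\mathcal{A}):=\frac{4}{\left(\Phi\left(\frac1\sigma\right)-\Phi(0)\right)\sqrt{2\pi\sigma^2}}\int_{K'\in\mathcal{A}}\exp\left(-\frac{\left(\delta^h\left(B_E,\frac{\alpha_0(K')}{(\Phi_4^{-1}(K'))_2}K'\right)\right)^2}{2\sigma^2}\right)\mathrm{d}\nu_0(K').$$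 The truncated normal distribution meant is the one (with mean $\frac12$ and variance $(\frac\sigma2)^2$) giving $[\frac12,c]$ the mass $\frac{\Phi\left(\frac{c-1/2}{\sigma/2}\right)-\Phi(0)}{\Phi(1/\sigma)-\Phi(0)}$.
   Formalization: With the constant 4 in P, the measure μ has total mass 4, so its pushforward by α₀ is not a probability distribution; it is proved instead that μ(K) = 4 and that the pushforward of μ/4 by α₀ has the truncated normal distribution. *)

theory Defs
  imports "HOL-Probability.Probability"
begin

section \<open>Convex bodies and the Hausdorff metric\<close>

text \<open>Convex bodies have nonempty interior: only then is the width positive (so that the
  thinness is below 1) and are the symmetric ones exactly the unit balls of norms.\<close>

definition convex_bodies :: "'a::euclidean_space set set" where
  "convex_bodies = {K. convex K \<and> compact K \<and> interior K \<noteq> {}}"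

definition symmetric_bodies :: "'a::euclidean_space set set" where
  "symmetric_bodies = {K \<in> convex_bodies. uminus ` K = K}"

text \<open>The value 0 off the bounded nonempty sets only serves to make the function nonnegative
  everywhere, as the locale \<^locale>\<open>Metric_space\<close> demands.\<close>

definition hausdorff_dist :: "'a::metric_space set \<Rightarrow> 'a set \<Rightarrow> real" where
  "hausdorff_dist K L =
     (if bounded K \<and> bounded L \<and> K \<noteq> {} \<and> L \<noteq> {}
      then max (SUP x\<in>K. infdist x L) (SUP y\<in>L. infdist y K) else 0)"

abbreviation hausdorff_topology :: "'a::metric_space set set \<Rightarrow> 'a set topology" where
  "hausdorff_topology X \<equiv> Metric_space.mtopology X hausdorff_dist"

definition hausdorff_borel :: "'a::metric_space set set \<Rightarrow> 'a set measure" where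
  "hausdorff_borel X = sigma X {U. openin (hausdorff_topology X) U}"

lemma bdd_above_infdist:
  fixes K L :: "'a::metric_space set"
  assumes "bounded K" "L \<noteq> {}"
  shows "bdd_above ((\<lambda>x. infdist x L) ` K)"
proof -
  obtain l where l: "l \<in> L" using assms(2) by auto
  obtain e where e: "\<And>x. x \<in> K \<Longrightarrow> dist l x \<le> e"
    using assms(1) bounded_any_center[of K l] by auto
  show ?thesis
    by (rule bdd_aboveI2[of _ _ e]) (metis l e infdist_le2 dist_commute)
qed

lemma hausdorff_dist_nonneg: "0 \<le> hausdorff_dist K L"
proof (cases "bounded K \<and> bounded L \<and> K \<noteq> {} \<and> L \<noteq> {}")
  case True
  then obtain x where x: "x \<in> K" by auto
  have "0 \<le> infdist x L" by (rule infdist_nonneg)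
  also have "\<dots> \<le> (SUP x\<in>K. infdist x L)"
    using True x by (intro cSUP_upper bdd_above_infdist) auto
  finally show ?thesis using True by (simp add: hausdorff_dist_def)
next
  case False
  then have "hausdorff_dist K L = 0" unfolding hausdorff_dist_def by (rule if_not_P)
  then show ?thesis by simp
qed

lemma hausdorff_dist_commute: "hausdorff_dist K L = hausdorff_dist L K"
  by (auto simp: hausdorff_dist_def max.commute)

lemma infdist_le_hausdorff_dist:
  assumes "bounded K" "bounded L" "L \<noteq> {}" "x \<in> K"
  shows "infdist x L \<le> hausdorff_dist K L"
proof -
  have "infdist x L \<le> (SUP x\<in>K. infdist x L)"
    using assms by (intro cSUP_upper bdd_above_infdist) auto
  then show ?thesis using assms by (auto simp: hausdorff_dist_def)
qed

lemma hausdorff_dist_le: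
  assumes "bounded K" "bounded L" "K \<noteq> {}" "L \<noteq> {}"
    and "\<And>x. x \<in> K \<Longrightarrow> infdist x L \<le> e" "\<And>y. y \<in> L \<Longrightarrow> infdist y K \<le> e"
  shows "hausdorff_dist K L \<le> e"
  using assms by (auto simp: hausdorff_dist_def intro!: cSUP_least)

lemma infdist_triangle_hausdorff:
  fixes K L M :: "'a::heine_borel set"
  assumes "bounded K" "compact L" "bounded M" "L \<noteq> {}" "M \<noteq> {}" "x \<in> K"
  shows "infdist x M \<le> hausdorff_dist K L + hausdorff_dist L M"
proof -
  obtain y where y: "y \<in> L" "infdist x L = dist x y"
    using infdist_attains_inf[of L x] assms compact_imp_closed by blast
  have "infdist x M \<le> infdist y M + dist x y" by (rule infdist_triangle)
  also have "infdist y M \<le> hausdorff_dist L M"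
    using assms y compact_imp_bounded by (intro infdist_le_hausdorff_dist) auto
  also have "dist x y \<le> hausdorff_dist K L"
    using assms compact_imp_bounded infdist_le_hausdorff_dist[of K L x] y by auto
  finally show ?thesis by simp
qed

lemma convex_bodiesD:
  assumes "K \<in> convex_bodies"
  shows "compact K" "bounded K" "closed K" "K \<noteq> {}"
  using assms by (auto simp: convex_bodies_def compact_imp_bounded compact_imp_closed)

lemma Metric_space_convex_bodies:
  "Metric_space (convex_bodies :: 'a::euclidean_space set set) hausdorff_dist"
proof
  fix K L :: "'a set"
  assume K: "K \<in> convex_bodies" and L: "L \<in> convex_bodies"
  note b = convex_bodiesD[OF K] convex_bodiesD[OF L]
  show "hausdorff_dist K L = 0 \<longleftrightarrow> K = L"
  proof
    assume h: "hausdorff_dist K L = 0"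
    have "x \<in> L" if "x \<in> K" for x
      using infdist_le_hausdorff_dist[of K L x] that b h infdist_nonneg[of x L]
      by (simp add: in_closed_iff_infdist_zero)
    moreover have "x \<in> K" if "x \<in> L" for x
      using infdist_le_hausdorff_dist[of L K x] that b h infdist_nonneg[of x K]
      by (simp add: in_closed_iff_infdist_zero hausdorff_dist_commute)
    ultimately show "K = L" by auto
  next
    assume "K = L"
    then have "hausdorff_dist K L \<le> 0"
      using b by (intro hausdorff_dist_le) auto
    then show "hausdorff_dist K L = 0"
      using hausdorff_dist_nonneg[of K L] by simp
  qed
next
  fix K L M :: "'a set"
  assume K: "K \<in> convex_bodies" and L: "L \<in> convex_bodies" and M: "M \<in> convex_bodies"
  note b = convex_bodiesD[OF K] convex_bodiesD[OF L] convex_bodiesD[OF M]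
  show "hausdorff_dist K M \<le> hausdorff_dist K L + hausdorff_dist L M"
  proof (rule hausdorff_dist_le)
    fix x assume "x \<in> K"
    then show "infdist x M \<le> hausdorff_dist K L + hausdorff_dist L M"
      using b by (intro infdist_triangle_hausdorff) auto
  next
    fix x assume "x \<in> M"
    then have "infdist x K \<le> hausdorff_dist M L + hausdorff_dist L K"
      using b by (intro infdist_triangle_hausdorff) auto
    then show "infdist x K \<le> hausdorff_dist K L + hausdorff_dist L M"
      by (simp add: hausdorff_dist_commute)
  qed (use b in auto)
qed (auto simp: hausdorff_dist_nonneg intro: hausdorff_dist_commute)


section \<open>Width, thinness and symmetrization\<close>

definition width :: "'a::euclidean_space set \<Rightarrow> real" where
  "width K = (INF u\<in>sphere 0 1. (SUP x\<in>K. u \<bullet> x) - (INF x\<in>K. u \<bullet> x))"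

definition thinness :: "'a::euclidean_space set \<Rightarrow> real" where
  "thinness K = diameter K / (width K + diameter K)"

definition symmetrization :: "'a::euclidean_space set \<Rightarrow> 'a set" where
  "symmetrization K = (\<lambda>x. (1/2) *\<^sub>R x) ` (K + uminus ` K)"

definition translate :: "'a::euclidean_space set \<Rightarrow> 'a \<Rightarrow> 'a set" where
  "translate K t = (\<lambda>x. x + t) ` K"


section \<open>The measure on symmetric bodies\<close>

definition normalized_bodies :: "'a::euclidean_space set set" where
  "normalized_bodies = {K \<in> symmetric_bodies. hausdorff_dist K (cball 0 1) = 1}"

definition scale_body :: "'a::euclidean_space set \<times> real \<Rightarrow> 'a set" where
  "scale_body = (\<lambda>(K, a). (\<lambda>x. a *\<^sub>R x) ` K)"

text \<open>On a symmetric body the preimage under \<^const>\<open>scale_body\<close> is unique, with positive second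
  component: a symmetric body of circumradius \<open>R\<close> is normalized iff \<open>R = 2\<close>.\<close>

definition scale_factor :: "'a::euclidean_space set \<Rightarrow> real" where
  "scale_factor K = snd (inv_into (normalized_bodies \<times> {0..}) scale_body K)"

definition product_law :: "'a::euclidean_space set measure \<Rightarrow> real measure \<Rightarrow> 'a set measure" where
  "product_law N1 N = distr (N1 \<Otimes>\<^sub>M N) (hausdorff_borel symmetric_bodies) scale_body"

abbreviation std_normal_cdf :: "real \<Rightarrow> real" where
  "std_normal_cdf \<equiv> cdf std_normal_distribution"

text \<open>For normalized \<open>K\<close> the distance between the unit ball and \<open>\<alpha> K\<close>, with \<open>\<alpha>\<close> the thinness
  of \<open>K\<close>, is \<open>2\<alpha> - 1\<close>. Hence, if the thinness is uniform under \<open>N1\<close>, the constant below gives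
  this measure the total mass 4 (constant 1 in place of 4 would give a probability measure).\<close>

definition thinness_measure ::
  "real \<Rightarrow> 'a::euclidean_space set measure \<Rightarrow> real measure \<Rightarrow> 'a set measure" where
  "thinness_measure \<sigma> N1 N = density (product_law N1 N) (\<lambda>K. ennreal
     (4 / ((std_normal_cdf (1/\<sigma>) - std_normal_cdf 0) * sqrt (2 * pi * \<sigma>\<^sup>2)) *
      exp (- (hausdorff_dist (cball 0 1) (scale_body (K, thinness K / scale_factor K)))\<^sup>2
             / (2 * \<sigma>\<^sup>2))))"


section \<open>Pullback and truncated normal distribution\<close>

definition pullback_measure :: "'a::euclidean_space set measure \<Rightarrow> 'a set measure" where
  "pullback_measure P =
     measure_of convex_bodies {symmetrization -` H \<inter> convex_bodies | H. H \<in> sets P}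
       (\<lambda>H. emeasure P (symmetrization ` H))"

text \<open>The normal distribution with mean 1/2 and variance \<open>(\<sigma>/2)\<^sup>2\<close>, truncated to \<open>[1/2, 1)\<close>.\<close>

definition truncated_normal :: "real \<Rightarrow> real measure \<Rightarrow> bool" where
  "truncated_normal \<sigma> D \<longleftrightarrow> prob_space D \<and> sets D = sets borel \<and> measure D {1/2..<1} = 1 \<and>
     (\<forall>c\<in>{1/2..<1}. measure D {1/2..c} =
        (std_normal_cdf ((c - 1/2) / (\<sigma>/2)) - std_normal_cdf 0) /
        (std_normal_cdf (1/\<sigma>) - std_normal_cdf 0))"

definition normalize_measure :: "'b measure \<Rightarrow> 'b measure" where
  "normalize_measure M = scale_measure (1 / emeasure M (space M)) M"

end

theory Submission
  imports Defs
begin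

text \<open>Symmetrization preserves the width in every direction and the diameter, hence the thinness,
  so everything reduces to the law of the thinness under \<open>P\<close>. A symmetric body of diameter \<open>d\<close> and
  width \<open>w\<close> lies in the ball of radius \<open>d/2\<close> and, by separation, contains the ball of radius
  \<open>w/2\<close>; its Hausdorff distance from the unit ball is thus governed by \<open>d/2 - 1\<close> and \<open>1 - w/2\<close>.
  For a body of thinness \<open>\<alpha>\<close> rescaled to \<open>d = 4 \<alpha>\<close> both numbers are \<open>2 \<alpha> - 1\<close>. Hence the density of
  \<open>P\<close> is a function of the thinness, and the law of the thinness is a uniform law weighted by
  \<open>exp (- (2 \<alpha> - 1)\<^sup>2 / (2 \<sigma>\<^sup>2))\<close>, which an affine substitution identifies.\<close>

text \<open>Images under a map need not respect disjointness, so \<open>P(m(H))\<close> is not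
  additive for arbitrary \<open>H\<close>. Thinness is measurable for this smaller sigma-algebra
  because it factors through \<open>symmetrization\<close>. A distance of exactly 1 from the unit
  ball means circumradius 2, hence diameter 4. This is where the scale factor d/4 and the rescaling
  to diameter 4 \<alpha> come from. The constant 4 in the density survives as total mass. The
  uniform law on [1/2, 1) has density 2, and the substitution \<alpha> = 1/2 + (\<sigma>/2) z has
  Jacobian \<sigma>/2. Together they turn the weight into 4/D times the standard normal density,
  with D its mass on [0, 1/\<sigma>]. The total is 4, so the truncated normal law is asserted after
  normalization.\<close>

section \<open>Width and diameter\<close>

text \<open>In terms of the support function h of \<open>K\<close> this is h(u) + h(-u). For a unit
  vector \<open>u\<close> it is the distance between the two supporting hyperplanes orthogonal to
  \<open>u\<close>.\<close>

definition dir_width :: "'a::euclidean_space \<Rightarrow> 'a set \<Rightarrow> real" where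
  "dir_width u K = (SUP x\<in>K. u \<bullet> x) - (INF x\<in>K. u \<bullet> x)"

lemma width_eq_INF: "width K = (INF u\<in>sphere 0 1. dir_width u K)"
  by (simp add: width_def dir_width_def)

lemma
  fixes K :: "'a::euclidean_space set"
  assumes "bounded K"
  shows bdd_above_inner: "bdd_above ((\<lambda>x. u \<bullet> x) ` K)"
    and bdd_below_inner: "bdd_below ((\<lambda>x. u \<bullet> x) ` K)"
proof -
  have "bounded ((\<lambda>x. u \<bullet> x) ` K)"
    by (rule bounded_linear_image[OF assms]) (rule bounded_linear_inner_right)
  then show "bdd_above ((\<lambda>x. u \<bullet> x) ` K)" "bdd_below ((\<lambda>x. u \<bullet> x) ` K)"
    by (auto intro: bounded_imp_bdd_above bounded_imp_bdd_below)
qed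

text \<open>Together with \<open>dir_width_le\<close> this allows later estimates to argue with
  pairs of points of \<open>K\<close> instead of suprema and infima.\<close>

lemma dir_width_ge:
  assumes "bounded K" "x \<in> K" "y \<in> K"
  shows "u \<bullet> x - u \<bullet> y \<le> dir_width u K"
  unfolding dir_width_def
  using cSUP_upper[OF assms(2) bdd_above_inner[OF assms(1), of u]]
    cINF_lower[OF bdd_below_inner[OF assms(1), of u] assms(3)] by linarith

lemma dir_width_le:
  assumes "K \<noteq> {}" "\<And>x y. x \<in> K \<Longrightarrow> y \<in> K \<Longrightarrow> u \<bullet> x - u \<bullet> y \<le> c"
  shows "dir_width u K \<le> c"
proof -
  have "(SUP x\<in>K. u \<bullet> x) \<le> c + (INF x\<in>K. u \<bullet> x)"
  proof (rule cSUP_least[OF assms(1)])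
    fix x assume x: "x \<in> K"
    have "u \<bullet> x - c \<le> (INF x\<in>K. u \<bullet> x)"
    proof (rule cINF_greatest[OF assms(1)])
      fix y assume "y \<in> K"
      then show "u \<bullet> x - c \<le> u \<bullet> y" using assms(2)[OF x, of y] by linarith
    qed
    then show "u \<bullet> x \<le> c + (INF x\<in>K. u \<bullet> x)" by simp
  qed
  then show ?thesis by (simp add: dir_width_def)
qed

lemma dir_width_nonneg:
  assumes "bounded K" "K \<noteq> {}"
  shows "0 \<le> dir_width u K"
  using dir_width_ge[OF assms(1), of _ _ u] assms(2) by fastforce

lemma width_le_dir_width:
  assumes "bounded K" "K \<noteq> {}" "norm u = 1"
  shows "width K \<le> dir_width u K"
  unfolding width_eq_INF using assms
  by (intro cINF_lower bdd_belowI2[of _ 0] dir_width_nonneg) auto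

lemma le_widthI:
  assumes "\<And>u. norm u = 1 \<Longrightarrow> c \<le> dir_width u K"
  shows "c \<le> width K"
  unfolding width_eq_INF using assms by (intro cINF_greatest) auto

lemma diameter_leI:
  fixes K :: "'a::real_normed_vector set"
  assumes "K \<noteq> {}" "\<And>x y. x \<in> K \<Longrightarrow> y \<in> K \<Longrightarrow> dist x y \<le> c"
  shows "diameter K \<le> c"
  using assms by (intro diameter_le) (auto simp: dist_norm)

lemma dir_width_le_diameter:
  assumes "bounded K" "K \<noteq> {}" "norm u = 1"
  shows "dir_width u K \<le> diameter K"
proof (rule dir_width_le[OF assms(2)])
  fix x y assume xy: "x \<in> K" "y \<in> K"
  have "u \<bullet> x - u \<bullet> y = u \<bullet> (x - y)" by (simp add: inner_diff_right)
  also have "\<dots> \<le> norm u * norm (x - y)" by (rule norm_cauchy_schwarz)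
  also have "\<dots> \<le> diameter K"
    using diameter_bounded_bound[OF assms(1) xy] assms(3) by (simp add: dist_norm)
  finally show "u \<bullet> x - u \<bullet> y \<le> diameter K" .
qed

lemma width_le_diameter:
  fixes K :: "'a::euclidean_space set"
  assumes "bounded K" "K \<noteq> {}"
  shows "width K \<le> diameter K"
proof -
  obtain u :: 'a where u: "norm u = 1" using vector_choose_size[of 1] by auto
  show ?thesis
    using width_le_dir_width[OF assms u] dir_width_le_diameter[OF assms u] by linarith
qed

text \<open>A ball of radius \<open>e\<close> inside \<open>K\<close> contains two points at
  distance \<open>2 * e\<close> along every direction \<open>u\<close>, a bound uniform in
  \<open>u\<close>.\<close>

lemma width_pos:
  assumes "K \<in> convex_bodies"
  shows "0 < width K"
proof -
  note b = convex_bodiesD[OF assms]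
  obtain c where "c \<in> interior K" using assms by (auto simp: convex_bodies_def)
  then obtain e where e: "e > 0" "cball c e \<subseteq> K" unfolding mem_interior_cball by blast
  have "2 * e \<le> width K"
  proof (rule le_widthI)
    fix u :: 'a assume u: "norm u = 1"
    have "c + e *\<^sub>R u \<in> K" "c - e *\<^sub>R u \<in> K"
      using e u by (auto intro!: subsetD[OF e(2)] simp: dist_norm)
    then have "u \<bullet> (c + e *\<^sub>R u) - u \<bullet> (c - e *\<^sub>R u) \<le> dir_width u K"
      by (intro dir_width_ge b)
    then show "2 * e \<le> dir_width u K"
      using u by (simp add: inner_simps flip: power2_norm_eq_inner)
  qed
  then show ?thesis using e by simp
qed

lemma diameter_pos: "K \<in> convex_bodies \<Longrightarrow> 0 < diameter K"
  using width_pos width_le_diameter convex_bodiesD(2,4) by (metis less_le_trans)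

lemma thinness_bounds:
  assumes "K \<in> convex_bodies"
  shows "thinness K \<in> {1/2..<1}"
  using width_pos[OF assms] diameter_pos[OF assms] width_le_diameter[of K] convex_bodiesD[OF assms]
  by (auto simp: thinness_def field_simps)


section \<open>Symmetrization\<close>

lemma mem_symmetrization:
  "z \<in> symmetrization K \<longleftrightarrow> (\<exists>x\<in>K. \<exists>y\<in>K. z = (1/2) *\<^sub>R (x - y))"
  by (force simp: symmetrization_def set_plus_def)

lemma symmetrization_memI:
  "x \<in> K \<Longrightarrow> y \<in> K \<Longrightarrow> (1/2) *\<^sub>R (x - y) \<in> symmetrization K"
  by (auto simp: mem_symmetrization)

lemma symmetric_convex_bodies: "symmetric_bodies \<subseteq> convex_bodies"
  by (auto simp: symmetric_bodies_def)

lemma symmetric_bodies_uminus: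
  "K \<in> symmetric_bodies \<Longrightarrow> x \<in> K \<Longrightarrow> - x \<in> K"
  by (auto simp: symmetric_bodies_def)

lemma symmetric_bodiesI:
  assumes "K \<in> convex_bodies" "\<And>x. x \<in> K \<Longrightarrow> - x \<in> K"
  shows "K \<in> symmetric_bodies"
proof -
  have "x \<in> uminus ` K" if "x \<in> K" for x
    using assms(2)[OF that] by (metis add.inverse_inverse imageI)
  then show ?thesis using assms by (auto simp: symmetric_bodies_def)
qed

lemma zero_in_symmetric_body:
  assumes "K \<in> symmetric_bodies"
  shows "0 \<in> K"
proof -
  have K: "convex K" "K \<in> convex_bodies"
    using assms by (auto simp: symmetric_bodies_def convex_bodies_def)
  obtain x where x: "x \<in> K" using convex_bodiesD(4)[OF K(2)] by auto
  have "(1/2) *\<^sub>R x + (1/2) *\<^sub>R (- x) \<in> K"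
    using x symmetric_bodies_uminus[OF assms x] by (intro convexD[OF K(1)]) auto
  then show ?thesis by simp
qed

lemma symmetrization_symmetric:
  assumes K: "K \<in> convex_bodies"
  shows "symmetrization K \<in> symmetric_bodies"
proof (rule symmetric_bodiesI)
  fix z assume "z \<in> symmetrization K"
  then obtain x y where "x \<in> K" "y \<in> K" "z = (1/2) *\<^sub>R (x - y)"
    by (auto simp: mem_symmetrization)
  then show "- z \<in> symmetrization K"
    using symmetrization_memI[of y K x] by (simp flip: scaleR_minus_right)
next
  have c: "convex K" "compact K" using K by (auto simp: convex_bodies_def)
  have eq: "uminus ` K = (\<lambda>x. (-1) *\<^sub>R x) ` K" by auto
  have "convex (uminus ` K)" "compact (uminus ` K)"
    unfolding eq using convex_scaling[OF c(1)] compact_scaling[OF c(2)] by blast+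
  moreover have "K + uminus ` K = {x + y | x y. x \<in> K \<and> y \<in> uminus ` K}"
    unfolding set_plus_def by blast
  ultimately have "convex (K + uminus ` K)" "compact (K + uminus ` K)"
    using c compact_sums[of K "uminus ` K"] convex_set_plus[of K "uminus ` K"] by simp_all
  then have "convex (symmetrization K)" "compact (symmetrization K)"
    unfolding symmetrization_def by (auto intro: convex_scaling compact_scaling)
  moreover have "interior (symmetrization K) \<noteq> {}"
  proof -
    obtain c where "c \<in> interior K" using K by (auto simp: convex_bodies_def)
    then obtain e where e: "e > 0" "ball c e \<subseteq> K" unfolding mem_interior by blast
    \<comment> \<open>\<open>z\<close> is half the difference of \<open>c + 2 *\<^sub>R z\<close>
      and \<open>c\<close>, so a ball about \<open>c\<close> in \<open>K\<close> becomes a ball of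
      half the radius about the origin.\<close>
    have "z \<in> symmetrization K" if "z \<in> ball 0 (e/2)" for z
    proof -
      have "c + 2 *\<^sub>R z \<in> K" using that by (intro subsetD[OF e(2)]) (auto simp: dist_norm)
      moreover have "c \<in> K" using e by auto
      ultimately show ?thesis using symmetrization_memI[of "c + 2 *\<^sub>R z" K c] by simp
    qed
    then have "0 \<in> interior (symmetrization K)"
      unfolding mem_interior using e(1) by (intro exI[of _ "e/2"]) auto
    then show ?thesis by auto
  qed
  ultimately show "symmetrization K \<in> convex_bodies" by (simp add: convex_bodies_def)
qed

lemma symmetrization_symmetric_body:
  assumes "K \<in> symmetric_bodies"
  shows "symmetrization K = K"
proof (intro equalityI subsetI)
  have K: "convex K" using assms by (auto simp: symmetric_bodies_def convex_bodies_def)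
  fix z assume "z \<in> symmetrization K"
  then obtain x y where z: "x \<in> K" "y \<in> K" "z = (1/2) *\<^sub>R (x - y)"
    by (auto simp: mem_symmetrization)
  have "(1/2) *\<^sub>R x + (1/2) *\<^sub>R (- y) \<in> K"
    using z symmetric_bodies_uminus[OF assms z(2)] by (intro convexD[OF K]) auto
  then show "z \<in> K" by (simp add: z(3) scaleR_diff_right)
next
  fix x assume x: "x \<in> K"
  have "(1/2) *\<^sub>R (x - (- x)) = x" using scaleR_half_double[of x] by simp
  then show "x \<in> symmetrization K"
    using symmetrization_memI[OF x symmetric_bodies_uminus[OF assms x]] by simp
qed

text \<open>Each symmetric body is its own preimage.\<close>

lemma symmetrization_surj: "symmetrization ` convex_bodies = symmetric_bodies"
proof (intro equalityI subsetI)
  fix K :: "'a set" assume "K \<in> symmetric_bodies"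
  then show "K \<in> symmetrization ` convex_bodies"
    using symmetrization_symmetric_body symmetric_convex_bodies by (metis imageI subsetD)
qed (auto intro: symmetrization_symmetric)

lemma symmetrization_translate: "symmetrization (translate K t) = symmetrization K"
proof -
  have "(x + t) - (y + t) = x - y" for x y by simp
  then show ?thesis by (auto simp: set_eq_iff mem_symmetrization translate_def)
qed

text \<open>Regrouping writes a difference of two half differences as half the sum of two
  differences of points of \<open>K\<close>, each of norm at most the diameter. Conversely, points
  x, y of \<open>K\<close> yield the antipodal points (x - y)/2 and (y - x)/2, which are as far
  apart as x and y.\<close>

lemma diameter_symmetrization:
  assumes K: "K \<in> convex_bodies"
  shows "diameter (symmetrization K) = diameter K"
proof (rule antisym)
  note b = convex_bodiesD[OF K]
    and b' = convex_bodiesD[OF subsetD[OF symmetric_convex_bodies symmetrization_symmetric[OF K]]]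
  show "diameter (symmetrization K) \<le> diameter K"
  proof (rule diameter_leI[OF b'(4)])
    fix z z' assume "z \<in> symmetrization K" "z' \<in> symmetrization K"
    then obtain x y x' y' where m: "x \<in> K" "y \<in> K" "x' \<in> K" "y' \<in> K"
      and z: "z = (1/2) *\<^sub>R (x - y)" "z' = (1/2) *\<^sub>R (x' - y')"
      by (auto simp: mem_symmetrization)
    have "z - z' = (1/2) *\<^sub>R ((x - x') + (y' - y))" by (simp add: z algebra_simps)
    then have "dist z z' \<le> (dist x x' + dist y' y) / 2"
      using norm_triangle_ineq[of "x - x'" "y' - y"] by (simp add: dist_norm)
    also have "\<dots> \<le> diameter K"
      using diameter_bounded_bound[OF b(2) m(1,3)] diameter_bounded_bound[OF b(2) m(4,2)] by simp
    finally show "dist z z' \<le> diameter K" .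
  qed
  show "diameter K \<le> diameter (symmetrization K)"
  proof (rule diameter_leI[OF b(4)])
    fix x y assume "x \<in> K" "y \<in> K"
    then have "dist ((1/2) *\<^sub>R (x - y)) ((1/2) *\<^sub>R (y - x)) \<le> diameter (symmetrization K)"
      by (intro diameter_bounded_bound[OF b'(2)] symmetrization_memI)
    moreover have "(1/2) *\<^sub>R (x - y) - (1/2) *\<^sub>R (y - x) = (1/2) *\<^sub>R ((x - y) + (x - y))"
      by (simp only: scaleR_diff_right scaleR_add_right) simp
    ultimately show "dist x y \<le> diameter (symmetrization K)" by (simp only: dist_norm scaleR_half_double)
  qed
qed

text \<open>The two pairings used for the diameter work again, with the inner product with
  \<open>u\<close> in place of the norm.\<close>

lemma dir_width_symmetrization:
  assumes K: "K \<in> convex_bodies"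
  shows "dir_width u (symmetrization K) = dir_width u K"
proof (rule antisym)
  note b = convex_bodiesD[OF K]
    and b' = convex_bodiesD[OF subsetD[OF symmetric_convex_bodies symmetrization_symmetric[OF K]]]
  show "dir_width u (symmetrization K) \<le> dir_width u K"
  proof (rule dir_width_le[OF b'(4)])
    fix z z' assume "z \<in> symmetrization K" "z' \<in> symmetrization K"
    then obtain x y x' y' where m: "x \<in> K" "y \<in> K" "x' \<in> K" "y' \<in> K"
      and z: "z = (1/2) *\<^sub>R (x - y)" "z' = (1/2) *\<^sub>R (x' - y')"
      by (auto simp: mem_symmetrization)
    show "u \<bullet> z - u \<bullet> z' \<le> dir_width u K"
      using dir_width_ge[OF b(2) m(1,3), of u] dir_width_ge[OF b(2) m(4,2), of u]
      by (simp add: z inner_simps) (simp add: field_simps)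
  qed
  show "dir_width u K \<le> dir_width u (symmetrization K)"
  proof (rule dir_width_le[OF b(4)])
    fix x y assume "x \<in> K" "y \<in> K"
    then have "u \<bullet> ((1/2) *\<^sub>R (x - y)) - u \<bullet> ((1/2) *\<^sub>R (y - x)) \<le> dir_width u (symmetrization K)"
      by (intro dir_width_ge[OF b'(2)] symmetrization_memI)
    then show "u \<bullet> x - u \<bullet> y \<le> dir_width u (symmetrization K)"
      by (simp add: inner_simps) (simp add: field_simps)
  qed
qed

lemma width_symmetrization: "K \<in> convex_bodies \<Longrightarrow> width (symmetrization K) = width K"
  by (simp add: width_eq_INF dir_width_symmetrization)

lemma thinness_symmetrization: "K \<in> convex_bodies \<Longrightarrow> thinness (symmetrization K) = thinness K"
  by (simp add: thinness_def width_symmetrization diameter_symmetrization)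


section \<open>Continuity in the Hausdorff metric\<close>

lemma Metric_space_hausdorff:
  "X \<subseteq> convex_bodies \<Longrightarrow> Metric_space (X :: 'a::euclidean_space set set) hausdorff_dist"
  using Metric_space.subspace[OF Metric_space_convex_bodies] .

text \<open>Continuity is always obtained from a Lipschitz estimate: constant 1 for symmetrization,
  2 for diameter and width, \<open>q\<close> for scaling by \<open>q\<close>.\<close>

lemma continuous_map_hausdorff_Lipschitz:
  fixes X :: "'a::euclidean_space set set"
  assumes "X \<subseteq> convex_bodies" "Metric_space Y d" "f ` X \<subseteq> Y" "C > 0"
    and L: "\<And>K L. K \<in> X \<Longrightarrow> L \<in> X \<Longrightarrow> d (f K) (f L) \<le> C * hausdorff_dist K L"
  shows "continuous_map (hausdorff_topology X) (Metric_space.mtopology Y d) f"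
  unfolding Metric_space.metric_continuous_map[OF Metric_space_hausdorff[OF assms(1)] assms(2)]
proof (intro conjI ballI allI impI)
  fix K and e :: real assume K: "K \<in> X" and e: "0 < e"
  show "\<exists>\<delta>>0. \<forall>L. L \<in> X \<and> hausdorff_dist K L < \<delta> \<longrightarrow> d (f K) (f L) < e"
  proof (intro exI[of _ "e / C"] conjI allI impI)
    fix L assume "L \<in> X \<and> hausdorff_dist K L < e / C"
    then show "d (f K) (f L) < e"
      using L[OF K, of L] \<open>C > 0\<close> by (simp add: field_simps)
  qed (use e \<open>C > 0\<close> in auto)
qed fact

text \<open>Bodies are closed, so the infimum in \<open>infdist\<close> is attained and no epsilon
  is lost. With \<open>hausdorff_dist_leI\<close> this reduces Hausdorff estimates to moving single
  points.\<close>

lemma hausdorff_dist_near: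
  assumes K: "K \<in> convex_bodies" and L: "L \<in> convex_bodies" and x: "x \<in> K"
  obtains y where "y \<in> L" "dist x y \<le> hausdorff_dist K L"
proof -
  note bK = convex_bodiesD[OF K] and bL = convex_bodiesD[OF L]
  obtain y where "y \<in> L" "infdist x L = dist x y"
    using infdist_attains_inf[OF bL(3,4)] by metis
  then show ?thesis
    using that infdist_le_hausdorff_dist[OF bK(2) bL(2,4) x] by metis
qed

lemma hausdorff_dist_leI:
  assumes K: "K \<in> convex_bodies" and L: "L \<in> convex_bodies"
    and "\<And>x. x \<in> K \<Longrightarrow> \<exists>y\<in>L. dist x y \<le> e" "\<And>y. y \<in> L \<Longrightarrow> \<exists>x\<in>K. dist y x \<le> e"
  shows "hausdorff_dist K L \<le> e"
  using assms(3,4) convex_bodiesD[OF K] convex_bodiesD[OF L]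
  by (intro hausdorff_dist_le) (auto intro: infdist_le2)

text \<open>Replacing x and y by near points of the other body moves (x - y)/2 by at most the
  average of the two errors.\<close>

lemma hausdorff_dist_symmetrization:
  assumes K: "K \<in> convex_bodies" and L: "L \<in> convex_bodies"
  shows "hausdorff_dist (symmetrization K) (symmetrization L) \<le> hausdorff_dist K L"
proof -
  \<comment> \<open>Stated for fresh \<open>K\<close> and \<open>L\<close>, since the Hausdorff
    distance requires the estimate in both directions.\<close>
  have *: "\<exists>z'\<in>symmetrization L. dist z z' \<le> hausdorff_dist K L"
    if K: "K \<in> convex_bodies" and L: "L \<in> convex_bodies" and "z \<in> symmetrization K"
    for K L :: "'a set" and z
  proof -
    obtain x y where xy: "x \<in> K" "y \<in> K" "z = (1/2) *\<^sub>R (x - y)"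
      using \<open>z \<in> symmetrization K\<close> by (auto simp: mem_symmetrization)
    obtain x' where x': "x' \<in> L" "dist x x' \<le> hausdorff_dist K L"
      using hausdorff_dist_near[OF K L xy(1)] .
    obtain y' where y': "y' \<in> L" "dist y y' \<le> hausdorff_dist K L"
      using hausdorff_dist_near[OF K L xy(2)] .
    have "z - (1/2) *\<^sub>R (x' - y') = (1/2) *\<^sub>R ((x - x') - (y - y'))"
      by (simp add: xy(3) algebra_simps)
    then have "dist z ((1/2) *\<^sub>R (x' - y')) \<le> (dist x x' + dist y y') / 2"
      using norm_triangle_ineq4[of "x - x'" "y - y'"] by (simp add: dist_norm)
    also have "\<dots> \<le> hausdorff_dist K L"
      using x' y' by simp
    finally have "dist z ((1/2) *\<^sub>R (x' - y')) \<le> hausdorff_dist K L" .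
    then show ?thesis using symmetrization_memI[OF x'(1) y'(1)] by blast
  qed
  show ?thesis
  proof (rule hausdorff_dist_leI)
    show "symmetrization K \<in> convex_bodies" "symmetrization L \<in> convex_bodies"
      using K L symmetrization_symmetric symmetric_convex_bodies by blast+
  next
    fix z assume "z \<in> symmetrization L"
    then show "\<exists>x\<in>symmetrization K. dist z x \<le> hausdorff_dist K L"
      using *[OF L K] by (simp add: hausdorff_dist_commute)
  qed (use *[OF K L] in blast)
qed

lemma continuous_map_symmetrization:
  "continuous_map (hausdorff_topology convex_bodies) (hausdorff_topology symmetric_bodies)
     (symmetrization :: 'a::euclidean_space set \<Rightarrow> 'a set)"
  using hausdorff_dist_symmetrization
  by (intro continuous_map_hausdorff_Lipschitz[where C = 1] Metric_space_hausdorff)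
    (auto simp: symmetrization_symmetric symmetric_convex_bodies)

text \<open>Each of the two end points moves by at most the Hausdorff distance, which explains the
  factor 2 here and in \<open>width_le_hausdorff\<close>.\<close>

lemma diameter_le_hausdorff:
  assumes K: "K \<in> convex_bodies" and L: "L \<in> convex_bodies"
  shows "diameter K \<le> diameter L + 2 * hausdorff_dist K L"
proof (rule diameter_leI)
  fix x y assume xy: "x \<in> K" "y \<in> K"
  obtain x' where x': "x' \<in> L" "dist x x' \<le> hausdorff_dist K L"
    using hausdorff_dist_near[OF K L xy(1)] .
  obtain y' where y': "y' \<in> L" "dist y y' \<le> hausdorff_dist K L"
    using hausdorff_dist_near[OF K L xy(2)] .
  have "dist x y \<le> dist x x' + dist x' y' + dist y y'"
    using dist_triangle[of x y x'] dist_triangle[of x' y y'] by (simp add: dist_commute)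
  also have "dist x' y' \<le> diameter L"
    using diameter_bounded_bound[OF convex_bodiesD(2)[OF L] x'(1) y'(1)] .
  finally show "dist x y \<le> diameter L + 2 * hausdorff_dist K L" using x' y' by linarith
qed (use convex_bodiesD[OF K] in auto)

lemma width_le_hausdorff:
  assumes K: "K \<in> convex_bodies" and L: "L \<in> convex_bodies"
  shows "width K \<le> width L + 2 * hausdorff_dist K L"
proof -
  note bK = convex_bodiesD[OF K] and bL = convex_bodiesD[OF L]
  have "width K - 2 * hausdorff_dist K L \<le> width L"
  proof (rule le_widthI)
    fix u :: 'a assume u: "norm u = 1"
    have "dir_width u K \<le> dir_width u L + 2 * hausdorff_dist K L"
    proof (rule dir_width_le[OF bK(4)])
      fix x y assume xy: "x \<in> K" "y \<in> K"
      obtain x' where x': "x' \<in> L" "dist x x' \<le> hausdorff_dist K L"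
        using hausdorff_dist_near[OF K L xy(1)] .
      obtain y' where y': "y' \<in> L" "dist y y' \<le> hausdorff_dist K L"
        using hausdorff_dist_near[OF K L xy(2)] .
      have "u \<bullet> (x - x') \<le> dist x x'" "u \<bullet> (y' - y) \<le> dist y y'"
        using norm_cauchy_schwarz[of u "x - x'"] norm_cauchy_schwarz[of u "y' - y"] u
        by (auto simp: dist_norm norm_minus_commute)
      then show "u \<bullet> x - u \<bullet> y \<le> dir_width u L + 2 * hausdorff_dist K L"
        using dir_width_ge[OF bL(2) x'(1) y'(1), of u] x' y' by (simp add: inner_diff_right)
    qed
    then show "width K - 2 * hausdorff_dist K L \<le> dir_width u L"
      using width_le_dir_width[OF bK(2,4) u] by linarith
  qed
  then show ?thesis by simp
qed

lemma continuous_map_diameter: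
  "X \<subseteq> convex_bodies \<Longrightarrow> continuous_map (hausdorff_topology X) euclidean diameter"
  and continuous_map_width:
  "X \<subseteq> convex_bodies \<Longrightarrow> continuous_map (hausdorff_topology X) euclidean width"
  for X :: "'a::euclidean_space set set"
proof -
  assume X: "X \<subseteq> convex_bodies"
  have "\<bar>diameter K - diameter L\<bar> \<le> 2 * hausdorff_dist K L"
    "\<bar>width K - width L\<bar> \<le> 2 * hausdorff_dist K L" if "K \<in> X" "L \<in> X" for K L
  proof -
    have "K \<in> convex_bodies" "L \<in> convex_bodies" using that X by auto
    then show "\<bar>diameter K - diameter L\<bar> \<le> 2 * hausdorff_dist K L"
      "\<bar>width K - width L\<bar> \<le> 2 * hausdorff_dist K L"
      using diameter_le_hausdorff[of K L] diameter_le_hausdorff[of L K]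
        width_le_hausdorff[of K L] width_le_hausdorff[of L K] hausdorff_dist_commute[of L K]
      by (simp_all add: abs_le_iff)
  qed
  note lip = this
    continuous_map_hausdorff_Lipschitz[where C = 2, OF X Met_TC.Metric_space_axioms,
      unfolded mtopology_is_euclidean]
  show "continuous_map (hausdorff_topology X) euclidean diameter"
    "continuous_map (hausdorff_topology X) euclidean width"
    using lip(1,2) by (auto intro!: lip(3) simp: dist_real_def)
qed

section \<open>Symmetric bodies and the unit ball\<close>

text \<open>The antipodal point also lies in \<open>K\<close>, at distance \<open>2 * norm x\<close>
  from \<open>x\<close>.\<close>

lemma norm_le_symmetric_body:
  assumes K: "K \<in> symmetric_bodies" and x: "x \<in> K"
  shows "norm x \<le> diameter K / 2"
proof -
  have "dist x (- x) \<le> diameter K"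
    using convex_bodiesD(2) K symmetric_convex_bodies x symmetric_bodies_uminus[OF K x]
    by (intro diameter_bounded_bound) auto
  moreover have "dist x (- x) = 2 * norm x"
    by (simp add: dist_norm flip: scaleR_2)
  ultimately show ?thesis by simp
qed

text \<open>By compactness two points realise the diameter. Their norms sum to at least the diameter
  while neither exceeds half of it, so both equal half of it.\<close>

lemma ex_norm_eq_symmetric_body:
  assumes K: "K \<in> symmetric_bodies"
  obtains x where "x \<in> K" "norm x = diameter K / 2"
proof -
  have "compact K" "K \<noteq> {}"
    using K symmetric_convex_bodies convex_bodiesD(1,4) by blast+
  then obtain x y where xy: "x \<in> K" "y \<in> K" "dist x y = diameter K"
    using diameter_compact_attained by metis
  have "diameter K \<le> norm x + norm y"
    using norm_triangle_ineq4[of x y] xy(3) by (simp add: dist_norm)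
  then have "norm x = diameter K / 2"
    using norm_le_symmetric_body[OF K xy(1)] norm_le_symmetric_body[OF K xy(2)] by simp
  with xy(1) that show ?thesis by metis
qed

lemma cball_subset_symmetric_body:
  assumes K: "K \<in> symmetric_bodies"
  shows "cball 0 (width K / 2) \<subseteq> K"
proof (rule ccontr)
  have c: "K \<in> convex_bodies" using K symmetric_convex_bodies by auto
  note b = convex_bodiesD[OF c]
  assume "\<not> ?thesis"
  then obtain z where "z \<in> cball 0 (width K / 2)" and z: "z \<notin> K" by blast
  then have zw: "norm z \<le> width K / 2" by simp
  obtain a \<beta> where a: "a \<bullet> z < \<beta>" "\<And>x. x \<in> K \<Longrightarrow> \<beta> < a \<bullet> x"
    using separating_hyperplane_closed_point[of K z] c b(3) z by (auto simp: convex_bodies_def)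
  have a0: "norm a > 0"
    using a(1) a(2)[OF zero_in_symmetric_body[OF K]] by auto
  define u where "u = (1 / norm a) *\<^sub>R a"
  have u: "norm u = 1" using a0 by (simp add: u_def)
  \<comment> \<open>By symmetry the one-sided bound holds on both sides, so the separating
    hyperplane and its mirror image enclose \<open>K\<close> in a slab. Here \<beta> is negative
    because \<open>K\<close> contains 0.\<close>
  have "dir_width u K \<le> 2 * (- \<beta> / norm a)"
  proof (rule dir_width_le[OF b(4)])
    fix x y assume xy: "x \<in> K" "y \<in> K"
    have "a \<bullet> x \<le> - \<beta>" "- (a \<bullet> y) \<le> - \<beta>"
      using a(2)[OF symmetric_bodies_uminus[OF K xy(1)]] a(2)[OF xy(2)] by auto
    then have "a \<bullet> x - a \<bullet> y \<le> 2 * - \<beta>" by simp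
    then show "u \<bullet> x - u \<bullet> y \<le> 2 * (- \<beta> / norm a)"
      using divide_right_mono[of "a \<bullet> x - a \<bullet> y" "2 * - \<beta>" "norm a"]
      by (simp add: u_def diff_divide_distrib)
  qed
  then have "width K / 2 \<le> - \<beta> / norm a"
    using width_le_dir_width[OF b(2,4) u] by linarith
  also have "\<dots> < norm z"
  proof -
    have "- \<beta> < - (a \<bullet> z)" using a(1) by simp
    also have "\<dots> \<le> norm a * norm z"
      using norm_cauchy_schwarz[of "- a" z] by simp
    finally show ?thesis using a0 by (simp add: field_simps)
  qed
  finally show False using zw by simp
qed

lemma unit_ball_convex_body: "cball 0 1 \<in> (convex_bodies :: 'a::euclidean_space set set)"
  by (auto simp: convex_bodies_def)

text \<open>Points are moved radially: those of the unit ball shrink into the ball of radius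
  \<open>width K / 2\<close>, those of \<open>K\<close> outside the unit ball are projected to its
  boundary.\<close>

lemma hausdorff_dist_unit_ball_le:
  assumes K: "K \<in> symmetric_bodies"
    and e: "diameter K / 2 - 1 \<le> e" "1 - width K / 2 \<le> e" "0 \<le> e"
  shows "hausdorff_dist (cball 0 1) K \<le> e"
proof (rule hausdorff_dist_leI[OF unit_ball_convex_body])
  show "K \<in> convex_bodies" using K symmetric_convex_bodies by auto
next
  fix x :: 'a assume x: "x \<in> cball 0 1"
  define r where "r = min 1 (width K / 2)"
  have r: "0 \<le> r" "r \<le> 1" "r \<le> width K / 2"
    using width_pos[of K] K symmetric_convex_bodies by (auto simp: r_def)
  have "norm (r *\<^sub>R x) \<le> width K / 2"
    using mult_mono[OF r(3), of "norm x" 1] r x by simp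
  then have "r *\<^sub>R x \<in> K" by (intro subsetD[OF cball_subset_symmetric_body[OF K]]) simp
  moreover have "dist x (r *\<^sub>R x) \<le> e"
  proof -
    have "x - r *\<^sub>R x = (1 - r) *\<^sub>R x" by (simp add: algebra_simps)
    then have "dist x (r *\<^sub>R x) = (1 - r) * norm x" using r by (simp add: dist_norm)
    also have "\<dots> \<le> 1 - r" using x r by (simp add: mult_left_le)
    also have "\<dots> \<le> e" using e by (auto simp: r_def min_def)
    finally show ?thesis .
  qed
  ultimately show "\<exists>y\<in>K. dist x y \<le> e" by blast
next
  fix x assume x: "x \<in> K"
  show "\<exists>y\<in>cball 0 1. dist x y \<le> e"
  proof (cases "norm x \<le> 1")
    case True
    then show ?thesis using e by (intro bexI[of _ x]) auto
  next
    case False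
    have "x - (1 / norm x) *\<^sub>R x = (1 - 1 / norm x) *\<^sub>R x" by (simp add: algebra_simps)
    then have "dist x ((1 / norm x) *\<^sub>R x) = \<bar>1 - 1 / norm x\<bar> * norm x"
      by (simp add: dist_norm)
    also have "\<bar>1 - 1 / norm x\<bar> = 1 - 1 / norm x"
      using False by (intro abs_of_nonneg) (simp add: divide_le_eq)
    also have "(1 - 1 / norm x) * norm x = norm x - 1"
      using False by (auto simp: left_diff_distrib)
    also have "\<dots> \<le> e" using norm_le_symmetric_body[OF K x] e by simp
    finally show ?thesis using False by (intro bexI[of _ "(1 / norm x) *\<^sub>R x"]) auto
  qed
qed

text \<open>A point of \<open>K\<close> of maximal norm is at least that norm minus 1 away from the
  unit ball.\<close>

lemma hausdorff_dist_unit_ball_ge: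
  assumes K: "K \<in> symmetric_bodies"
  shows "diameter K / 2 - 1 \<le> hausdorff_dist (cball 0 1) K"
proof -
  obtain x where x: "x \<in> K" "norm x = diameter K / 2"
    using ex_norm_eq_symmetric_body[OF K] .
  obtain y where y: "y \<in> cball 0 1" "dist x y \<le> hausdorff_dist K (cball 0 1)"
    using hausdorff_dist_near[OF _ unit_ball_convex_body x(1)] K symmetric_convex_bodies by auto
  have "norm x \<le> dist x y + norm y" by (simp add: dist_norm norm_triangle_sub add.commute)
  then show ?thesis using x y by (simp add: hausdorff_dist_commute)
qed

text \<open>The positive width keeps \<open>1 - width K / 2\<close> strictly below 1, so distance 1
  from the unit ball can only come from \<open>diameter K / 2 - 1\<close>.\<close>

lemma normalized_bodies_iff:
  "K \<in> normalized_bodies \<longleftrightarrow> K \<in> symmetric_bodies \<and> diameter K = 4"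
proof (cases "K \<in> symmetric_bodies")
  case K: True
  then have w: "width K > 0" using width_pos symmetric_convex_bodies by blast
  have "hausdorff_dist (cball 0 1) K = 1 \<longleftrightarrow> diameter K = 4"
  proof
    assume h: "hausdorff_dist (cball 0 1) K = 1"
    have "1 \<le> max 0 (max (diameter K / 2 - 1) (1 - width K / 2))"
      using hausdorff_dist_unit_ball_le[OF K, of "max 0 (max (diameter K / 2 - 1) (1 - width K / 2))"]
      by (simp add: h)
    then show "diameter K = 4"
      using w hausdorff_dist_unit_ball_ge[OF K] h by (auto simp: max_def split: if_splits)
  next
    assume "diameter K = 4"
    then show "hausdorff_dist (cball 0 1) K = 1"
      using w hausdorff_dist_unit_ball_ge[OF K] hausdorff_dist_unit_ball_le[OF K, of 1] by simp
  qed
  then show ?thesis using K by (simp add: normalized_bodies_def hausdorff_dist_commute)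
qed (simp add: normalized_bodies_def)


section \<open>Scaling\<close>

lemma scale_body_eq: "scale_body (K, a) = (\<lambda>x. a *\<^sub>R x) ` K"
  by (simp add: scale_body_def)

lemma scale_body_symmetric:
  assumes K: "K \<in> symmetric_bodies" and "a > 0"
  shows "scale_body (K, a) \<in> symmetric_bodies"
proof (rule symmetric_bodiesI)
  have c: "convex K" "compact K" "interior K \<noteq> {}"
    using K by (auto simp: symmetric_bodies_def convex_bodies_def)
  have "interior (scale_body (K, a)) = (\<lambda>x. a *\<^sub>R x) ` interior K"
    unfolding scale_body_eq using \<open>a > 0\<close>
    by (intro interior_injective_linear_image linear_scaleR) (auto simp: inj_on_def)
  then show "scale_body (K, a) \<in> convex_bodies"
    using c convex_scaling[OF c(1)] compact_scaling[OF c(2)]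
    by (auto simp: convex_bodies_def scale_body_eq)
next
  fix x assume "x \<in> scale_body (K, a)"
  then obtain y where y: "y \<in> K" "x = a *\<^sub>R y" by (auto simp: scale_body_eq)
  then have "- x = a *\<^sub>R (- y)" by simp
  then show "- x \<in> scale_body (K, a)"
    using symmetric_bodies_uminus[OF K y(1)] unfolding scale_body_eq by blast
qed

lemma scale_body_scale_body: "scale_body (scale_body (K, a), b) = scale_body (K, b * a)"
  by (simp add: scale_body_eq image_image)

lemma scale_body_1: "scale_body (K, 1) = K"
  by (simp add: scale_body_eq)

text \<open>The factor 0 is included because \<open>scale_factor\<close> chooses its preimage from a
  half-line that contains 0.\<close>

lemma diameter_scale_body:
  fixes K :: "'a::euclidean_space set"
  assumes "bounded K" "K \<noteq> {}" "0 \<le> a"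
  shows "diameter (scale_body (K, a)) = a * diameter K"
proof (rule antisym)
  show "diameter (scale_body (K, a)) \<le> a * diameter K"
  proof (rule diameter_leI)
    fix x y assume "x \<in> scale_body (K, a)" "y \<in> scale_body (K, a)"
    then obtain x' y' where xy: "x' \<in> K" "y' \<in> K" "x = a *\<^sub>R x'" "y = a *\<^sub>R y'"
      by (auto simp: scale_body_eq)
    then show "dist x y \<le> a * diameter K"
      using diameter_bounded_bound[OF assms(1) xy(1,2)] assms(3)
      by (simp add: dist_norm mult_left_mono flip: scaleR_diff_right)
  qed (use assms in \<open>simp add: scale_body_eq\<close>)
  have b: "bounded (scale_body (K, a))"
    using bounded_scaling[OF assms(1)] by (simp add: scale_body_eq)
  show "a * diameter K \<le> diameter (scale_body (K, a))"
  proof (cases "a = 0")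
    case False
    then have a: "a > 0" using assms by simp
    have "diameter K \<le> diameter (scale_body (K, a)) / a"
    proof (rule diameter_leI[OF assms(2)])
      fix x y assume "x \<in> K" "y \<in> K"
      then have "dist (a *\<^sub>R x) (a *\<^sub>R y) \<le> diameter (scale_body (K, a))"
        by (intro diameter_bounded_bound[OF b]) (auto simp: scale_body_eq)
      then show "dist x y \<le> diameter (scale_body (K, a)) / a"
        using a by (simp add: dist_norm pos_le_divide_eq mult.commute flip: scaleR_diff_right)
    qed
    then show ?thesis using a by (simp add: field_simps)
  qed (use diameter_ge_0[OF b] in simp)
qed

lemma width_scale_body_le:
  fixes K :: "'a::euclidean_space set"
  assumes "bounded K" "K \<noteq> {}" "0 < a"
  shows "width (scale_body (K, a)) \<le> a * width K"
proof -
  have b: "bounded (scale_body (K, a))" "scale_body (K, a) \<noteq> {}"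
    using bounded_scaling[OF assms(1)] assms(2) by (auto simp: scale_body_eq)
  have "width (scale_body (K, a)) / a \<le> width K"
  proof (rule le_widthI)
    fix u :: 'a assume u: "norm u = 1"
    have "dir_width u (scale_body (K, a)) \<le> a * dir_width u K"
    proof (rule dir_width_le[OF b(2)])
      fix x y assume "x \<in> scale_body (K, a)" "y \<in> scale_body (K, a)"
      then obtain x' y' where xy: "x' \<in> K" "y' \<in> K" "x = a *\<^sub>R x'" "y = a *\<^sub>R y'"
        by (auto simp: scale_body_eq)
      then show "u \<bullet> x - u \<bullet> y \<le> a * dir_width u K"
        using mult_left_mono[OF dir_width_ge[OF assms(1) xy(1,2), of u], of a] assms(3)
        by (simp add: right_diff_distrib)
    qed
    then show "width (scale_body (K, a)) / a \<le> dir_width u K"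
      using width_le_dir_width[OF b u] assms(3) by (simp add: field_simps)
  qed
  then show ?thesis using assms(3) by (simp add: field_simps)
qed

lemma width_scale_body:
  fixes K :: "'a::euclidean_space set"
  assumes "bounded K" "K \<noteq> {}" "0 < a"
  shows "width (scale_body (K, a)) = a * width K"
proof (rule antisym)
  have b: "bounded (scale_body (K, a))" "scale_body (K, a) \<noteq> {}"
    using bounded_scaling[OF assms(1)] assms(2) by (auto simp: scale_body_eq)
  \<comment> \<open>The reverse inequality is the one already proved, applied to the inverse
    scaling.\<close>
  have "width K \<le> (1 / a) * width (scale_body (K, a))"
    using width_scale_body_le[OF b, of "1 / a"] assms(3)
    by (simp add: scale_body_scale_body scale_body_1)
  then show "a * width K \<le> width (scale_body (K, a))"
    using assms(3) by (simp add: field_simps)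
qed (rule width_scale_body_le[OF assms])

lemma thinness_scale_body:
  fixes K :: "'a::euclidean_space set"
  assumes "bounded K" "K \<noteq> {}" "0 < a"
  shows "thinness (scale_body (K, a)) = thinness K"
  using assms
  by (simp add: thinness_def diameter_scale_body width_scale_body flip: distrib_left)

text \<open>Normalized bodies have diameter 4, so every preimage of \<open>K\<close> has second
  component \<open>diameter K / 4\<close>, whichever one \<open>inv_into\<close> picks. Rescaling
  \<open>K\<close> to diameter 4 shows that a preimage exists.\<close>

lemma scale_factor_eq:
  assumes K: "K \<in> symmetric_bodies"
  shows "scale_factor K = diameter K / 4"
proof -
  have c: "K \<in> convex_bodies" using K symmetric_convex_bodies by auto
  note d = diameter_pos[OF c] and b = convex_bodiesD[OF c]
  have "scale_body (K, 4 / diameter K) \<in> normalized_bodies"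
    using d b by (simp add: normalized_bodies_iff scale_body_symmetric[OF K] diameter_scale_body)
  moreover have "scale_body (scale_body (K, 4 / diameter K), diameter K / 4) = K"
    using d by (simp add: scale_body_scale_body scale_body_1)
  ultimately have "K \<in> scale_body ` (normalized_bodies \<times> {0..})"
    using d by (intro image_eqI[of _ _ "(scale_body (K, 4 / diameter K), diameter K / 4)"]) auto
  then obtain L a where La: "inv_into (normalized_bodies \<times> {0..}) scale_body K = (L, a)"
    "L \<in> normalized_bodies" "0 \<le> a" "scale_body (L, a) = K"
    using inv_into_into[of K scale_body] f_inv_into_f[of K scale_body]
    by (metis (no_types, lifting) SigmaE atLeast_iff)
  have "L \<in> convex_bodies" "diameter L = 4"
    using La(2) symmetric_convex_bodies by (auto simp: normalized_bodies_iff)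
  then have "diameter K = a * 4"
    using diameter_scale_body[of L a] La(3,4) convex_bodiesD by metis
  then show ?thesis by (simp add: scale_factor_def La(1))
qed

lemma hausdorff_dist_unit_ball_thinness:
  assumes K: "K \<in> symmetric_bodies"
  shows "hausdorff_dist (cball 0 1) (scale_body (K, thinness K / scale_factor K)) =
    2 * thinness K - 1"
proof -
  have c: "K \<in> convex_bodies" using K symmetric_convex_bodies by auto
  note d = diameter_pos[OF c] and w = width_pos[OF c] and b = convex_bodiesD[OF c]
    and t = thinness_bounds[OF c]
  define a where "a = thinness K / scale_factor K"
  have a: "a = 4 * thinness K / diameter K"
    by (simp add: a_def scale_factor_eq[OF K])
  have a0: "a > 0" using t d by (auto simp: a)
  have "diameter (scale_body (K, a)) = 4 * thinness K"
    using diameter_scale_body[OF b(2,4), of a] a0 d by (simp add: a)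
  moreover have "width (scale_body (K, a)) = 4 * (1 - thinness K)"
  proof -
    \<comment> \<open>With w the width and d the diameter, \<open>1 - thinness K\<close> is w/(w +
      d). After rescaling, half the width thus falls short of 1 by exactly as much as half the
      diameter exceeds it.\<close>
    have "thinness K * width K = diameter K * (1 - thinness K)"
      using d w by (simp add: thinness_def field_simps)
    then show ?thesis
      using width_scale_body[OF b(2,4) a0] d by (simp add: a mult.assoc)
  qed
  ultimately show ?thesis
    using hausdorff_dist_unit_ball_le[OF scale_body_symmetric[OF K a0], of "2 * thinness K - 1"]
      hausdorff_dist_unit_ball_ge[OF scale_body_symmetric[OF K a0]] t
    by (simp add: field_simps flip: a_def)
qed

lemma hausdorff_dist_scale_body:
  assumes K: "K \<in> symmetric_bodies" and L: "L \<in> symmetric_bodies" and a: "a > 0"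
  shows "hausdorff_dist (scale_body (K, a)) (scale_body (L, a)) \<le> a * hausdorff_dist K L"
proof -
  have *: "\<exists>z\<in>scale_body (L, a). dist x z \<le> a * hausdorff_dist K L"
    if K: "K \<in> convex_bodies" and L: "L \<in> convex_bodies" and x: "x \<in> scale_body (K, a)"
    for K L :: "'a set" and x
  proof -
    obtain y where y: "y \<in> K" "x = a *\<^sub>R y" using x by (auto simp: scale_body_eq)
    obtain z where z: "z \<in> L" "dist y z \<le> hausdorff_dist K L"
      using hausdorff_dist_near[OF K L y(1)] .
    have "dist x (a *\<^sub>R z) = a * dist y z"
      using a by (simp add: y(2) dist_norm flip: scaleR_diff_right)
    then show ?thesis using z a by (auto simp: scale_body_eq intro!: bexI[of _ z])
  qed
  have c: "K \<in> convex_bodies" "L \<in> convex_bodies"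
    using K L symmetric_convex_bodies by auto
  show ?thesis
  proof (rule hausdorff_dist_leI)
    show "scale_body (K, a) \<in> convex_bodies" "scale_body (L, a) \<in> convex_bodies"
      using K L a scale_body_symmetric symmetric_convex_bodies by blast+
  next
    fix x assume "x \<in> scale_body (L, a)"
    then show "\<exists>z\<in>scale_body (K, a). dist x z \<le> a * hausdorff_dist K L"
      using *[OF c(2,1)] by (simp add: hausdorff_dist_commute)
  qed (use *[OF c] in blast)
qed

text \<open>The constant 2 is the circumradius of a normalized body. The bound is uniform in
  \<open>K\<close>, which lets \<open>measurable_scale_body\<close> use rectangles.\<close>

lemma hausdorff_dist_scale_body_normalized:
  assumes K: "K \<in> normalized_bodies" and ab: "a > 0" "b > 0"
  shows "hausdorff_dist (scale_body (K, a)) (scale_body (K, b)) \<le> 2 * \<bar>a - b\<bar>"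
proof (rule hausdorff_dist_leI)
  have K': "K \<in> symmetric_bodies" "diameter K = 4" using K by (auto simp: normalized_bodies_iff)
  show "scale_body (K, a) \<in> convex_bodies" "scale_body (K, b) \<in> convex_bodies"
    using K' ab scale_body_symmetric symmetric_convex_bodies by blast+
  have *: "dist (c *\<^sub>R x) (d *\<^sub>R x) \<le> 2 * \<bar>c - d\<bar>" if "x \<in> K" for c d x
    using mult_left_mono[OF norm_le_symmetric_body[OF K'(1) that], of "\<bar>c - d\<bar>"] K'(2)
    by (simp add: dist_norm mult.commute flip: scaleR_diff_left)
  show "\<exists>y\<in>scale_body (K, b). dist x y \<le> 2 * \<bar>a - b\<bar>" if "x \<in> scale_body (K, a)" for x
    using that * unfolding scale_body_eq by blast
  show "\<exists>x\<in>scale_body (K, a). dist y x \<le> 2 * \<bar>a - b\<bar>" if "y \<in> scale_body (K, b)" for y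
    using that * unfolding scale_body_eq abs_minus_commute[of a b] by blast
qed

section \<open>Borel sets of bodies\<close>

lemma
  fixes X :: "'a::euclidean_space set set"
  assumes "X \<subseteq> convex_bodies"
  shows space_hausdorff_borel: "space (hausdorff_borel X) = X"
    and hausdorff_borel_openin: "openin (hausdorff_topology X) U \<Longrightarrow> U \<in> sets (hausdorff_borel X)"
    and hausdorff_borel_closedin: "closedin (hausdorff_topology X) U \<Longrightarrow> U \<in> sets (hausdorff_borel X)"
    and openin_hausdorff_Pow: "{U. openin (hausdorff_topology X) U} \<subseteq> Pow X"
proof -
  interpret Metric_space X hausdorff_dist by (rule Metric_space_hausdorff[OF assms])
  show 1: "{U. openin (hausdorff_topology X) U} \<subseteq> Pow X"
    using openin_subset by fastforce
  show 2: "space (hausdorff_borel X) = X"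
    using 1 by (simp add: hausdorff_borel_def space_measure_of)
  show 3: "U \<in> sets (hausdorff_borel X)" if "openin (hausdorff_topology X) U" for U
    using 1 that by (simp add: hausdorff_borel_def)
  show "U \<in> sets (hausdorff_borel X)" if "closedin (hausdorff_topology X) U"
  proof -
    have "X - U \<in> sets (hausdorff_borel X)" "U \<subseteq> X"
      using that 3 by (auto simp: closedin_def)
    then show ?thesis
      using sets.compl_sets[of "X - U" "hausdorff_borel X"] by (simp add: 2 double_diff)
  qed
qed

lemma measurable_hausdorff_continuous:
  fixes X :: "'a::euclidean_space set set" and Y :: "'b::euclidean_space set set"
  assumes X: "X \<subseteq> convex_bodies" and Y: "Y \<subseteq> convex_bodies"
    and f: "continuous_map (hausdorff_topology X) (hausdorff_topology Y) f"
  shows "f \<in> hausdorff_borel X \<rightarrow>\<^sub>M hausdorff_borel Y"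
  unfolding hausdorff_borel_def[of Y]
proof (rule measurable_measure_of[OF openin_hausdorff_Pow[OF Y]])
  interpret X: Metric_space X hausdorff_dist by (rule Metric_space_hausdorff[OF X])
  interpret Y: Metric_space Y hausdorff_dist by (rule Metric_space_hausdorff[OF Y])
  show "f \<in> space (hausdorff_borel X) \<rightarrow> Y"
    using continuous_map_funspace[OF f] by (simp add: space_hausdorff_borel[OF X])
  fix U assume "U \<in> {U. openin (hausdorff_topology Y) U}"
  then have "openin (hausdorff_topology X) {x \<in> X. f x \<in> U}"
    using openin_continuous_map_preimage[OF f, of U] by simp
  moreover have "{x \<in> X. f x \<in> U} = f -` U \<inter> X" by auto
  ultimately show "f -` U \<inter> space (hausdorff_borel X) \<in> sets (hausdorff_borel X)"
    using hausdorff_borel_openin[OF X] by (simp add: space_hausdorff_borel[OF X])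
qed

lemma borel_measurable_hausdorff_continuous:
  fixes X :: "'a::euclidean_space set set" and f :: "'a set \<Rightarrow> real"
  assumes X: "X \<subseteq> convex_bodies"
    and f: "continuous_map (hausdorff_topology X) euclidean f"
  shows "f \<in> borel_measurable (hausdorff_borel X)"
proof (rule borel_measurableI)
  interpret X: Metric_space X hausdorff_dist by (rule Metric_space_hausdorff[OF X])
  fix S :: "real set" assume "open S"
  then have "openin (hausdorff_topology X) {x \<in> X. f x \<in> S}"
    using openin_continuous_map_preimage[OF f, of S] by simp
  moreover have "{x \<in> X. f x \<in> S} = f -` S \<inter> X" by auto
  ultimately show "f -` S \<inter> space (hausdorff_borel X) \<in> sets (hausdorff_borel X)"
    using hausdorff_borel_openin[OF X] by (simp add: space_hausdorff_borel[OF X])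
qed

lemma borel_measurable_thinness:
  fixes X :: "'a::euclidean_space set set"
  assumes X: "X \<subseteq> convex_bodies"
  shows "thinness \<in> borel_measurable (hausdorff_borel X)"
proof -
  note [measurable] =
    borel_measurable_hausdorff_continuous[OF X continuous_map_diameter[OF X]]
    borel_measurable_hausdorff_continuous[OF X continuous_map_width[OF X]]
  show ?thesis unfolding thinness_def[abs_def] by measurable
qed

text \<open>The open set \<open>U\<close> is pulled back as a countable union of rectangles, indexed by a rational
  approximation \<open>q\<close> of the scaling factor and a rational margin \<open>r\<close>. This way the product
  \<open>\<sigma>\<close>-algebra is reached without separability of the space of bodies.\<close>

lemma measurable_scale_body:
  "scale_body \<in> hausdorff_borel (normalized_bodies :: 'a::euclidean_space set set)
      \<Otimes>\<^sub>M restrict_space borel {0<..} \<rightarrow>\<^sub>M hausdorff_borel symmetric_bodies"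
    (is "_ \<in> ?M \<rightarrow>\<^sub>M _")
  unfolding hausdorff_borel_def[of symmetric_bodies]
proof (rule measurable_measure_of[OF openin_hausdorff_Pow[OF symmetric_convex_bodies]])
  have N: "(normalized_bodies :: 'a set set) \<subseteq> symmetric_bodies"
    by (auto simp: normalized_bodies_def)
  then have N': "(normalized_bodies :: 'a set set) \<subseteq> convex_bodies"
    using symmetric_convex_bodies by blast
  interpret S: Metric_space "symmetric_bodies :: 'a set set" hausdorff_dist
    by (rule Metric_space_hausdorff[OF symmetric_convex_bodies])
  have spM: "space ?M = normalized_bodies \<times> {0<..}"
    by (simp add: space_pair_measure space_hausdorff_borel[OF N'] space_restrict_space)
  show "scale_body \<in> space ?M \<rightarrow> symmetric_bodies"
    using N by (auto simp: spM intro!: scale_body_symmetric)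
  fix U :: "'a set set" assume "U \<in> {U. openin (hausdorff_topology symmetric_bodies) U}"
  then have U: "openin S.mtopology U" by simp
  \<comment> \<open>For positive \<open>r\<close> these are the bodies of \<open>U\<close> at
    distance at least \<open>r\<close> from every symmetric body outside \<open>U\<close>. Removing
    open balls leaves a closed set, so each \<open>V q r\<close> is closed as well.\<close>
  define G where "G r = symmetric_bodies - (\<Union>L\<in>symmetric_bodies - U. S.mball L r)" for r
  define V where "V q r = {K \<in> normalized_bodies. scale_body (K, q) \<in> G r}" for q r
  define Q where "Q = {(q, r). q \<in> \<rat> \<and> r \<in> \<rat> \<and> (0::real) < q \<and> (0::real) < r}"
  have V: "V q r \<in> sets (hausdorff_borel normalized_bodies)" if "q > 0" for q r
  proof -
    have "continuous_map (hausdorff_topology normalized_bodies) S.mtopology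
        (\<lambda>K. scale_body (K, q))"
      using that hausdorff_dist_scale_body[OF subsetD[OF N] subsetD[OF N]]
        scale_body_symmetric[OF subsetD[OF N]]
      by (intro continuous_map_hausdorff_Lipschitz[OF N' S.Metric_space_axioms, where C = q]) auto
    moreover have "closedin S.mtopology (G r)"
      unfolding G_def by (intro closedin_diff openin_Union) auto
    ultimately have "closedin (hausdorff_topology normalized_bodies)
        {K \<in> topspace (hausdorff_topology normalized_bodies). scale_body (K, q) \<in> G r}"
      by (rule closedin_continuous_map_preimage)
    then show ?thesis
      using hausdorff_borel_closedin[OF N']
      by (simp add: V_def Metric_space.topspace_mtopology[OF Metric_space_hausdorff[OF N']])
  qed
  have "scale_body -` U \<inter> space ?M =
    (\<Union>(q, r)\<in>Q. V q r \<times> ({a. 2 * \<bar>a - q\<bar> < r} \<inter> {0<..}))" (is "?A = ?B")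
  proof (intro equalityI subsetI)
    fix p assume "p \<in> ?A"
    then obtain K a where p: "p = (K, a)" "K \<in> normalized_bodies" "a > 0" "scale_body (K, a) \<in> U"
      by (auto simp: spM)
    obtain e where e: "e > 0" "S.mball (scale_body (K, a)) e \<subseteq> U"
      using U p(4) unfolding S.openin_mtopology by blast
    \<comment> \<open>Changing the factor from \<open>a\<close> to \<open>q\<close> costs less than
      \<open>r\<close>, and a body within \<open>r\<close> of the result is then less than
      \<open>2 * r\<close>, hence less than \<open>e\<close>, from the starting body.\<close>
    obtain r where r: "r \<in> \<rat>" "0 < r" "r < e / 2"
      using Rats_dense_in_real[of 0 "e / 2"] e by auto
    obtain q where q: "q \<in> \<rat>" "a < q" "q < a + r / 2"
      using Rats_dense_in_real[of a "a + r / 2"] r by auto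
    have s: "scale_body (K, a) \<in> symmetric_bodies" "scale_body (K, q) \<in> symmetric_bodies"
      using p q N by (auto intro!: scale_body_symmetric)
    have h: "hausdorff_dist (scale_body (K, a)) (scale_body (K, q)) < r"
      using hausdorff_dist_scale_body_normalized[OF p(2,3), of q] p q by simp
    have "scale_body (K, q) \<in> G r"
    proof (rule ccontr)
      assume "scale_body (K, q) \<notin> G r"
      then obtain L where L: "L \<in> symmetric_bodies" "L \<notin> U"
        "hausdorff_dist L (scale_body (K, q)) < r"
        using s by (auto simp: G_def)
      have "hausdorff_dist (scale_body (K, a)) L < e"
        using S.triangle[OF s L(1)] h L(3) r(3) hausdorff_dist_commute[of L] by simp
      then show False using e(2) L s by auto
    qed
    moreover have "2 * \<bar>a - q\<bar> < r" using q by simp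
    ultimately have "(q, r) \<in> Q" "(K, a) \<in> V q r \<times> ({a. 2 * \<bar>a - q\<bar> < r} \<inter> {0<..})"
      using p q r by (auto simp: Q_def V_def)
    then show "p \<in> ?B" unfolding p(1) by blast
  next
    fix p assume "p \<in> ?B"
    then obtain K a q r where p: "p = (K, a)" "K \<in> normalized_bodies" "a > 0" "q > 0"
      "scale_body (K, q) \<in> G r" "2 * \<bar>a - q\<bar> < r"
      by (auto simp: Q_def V_def)
    have s: "scale_body (K, a) \<in> symmetric_bodies" "scale_body (K, q) \<in> symmetric_bodies"
      using p N by (auto intro!: scale_body_symmetric)
    \<comment> \<open>Were the first body outside \<open>U\<close>, its ball of radius
      \<open>r\<close> would contain the second one and exclude it from \<open>G r\<close>.\<close>
    have "hausdorff_dist (scale_body (K, a)) (scale_body (K, q)) < r"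
      using hausdorff_dist_scale_body_normalized[OF p(2,3,4)] p(6) by simp
    then have "scale_body (K, a) \<in> U"
      using p(5) s by (auto simp: G_def)
    then show "p \<in> ?A" using p by (simp add: spM)
  qed
  moreover have "countable Q"
  proof (rule countable_subset)
    show "Q \<subseteq> \<rat> \<times> \<rat>" by (auto simp: Q_def)
  qed (intro countable_SIGMA countable_rat)
  moreover have "V q r \<times> ({a. 2 * \<bar>a - q\<bar> < r} \<inter> {0<..}) \<in> sets ?M" if "(q, r) \<in> Q" for q r
  proof (rule pair_measureI)
    have "{a. 2 * \<bar>a - q\<bar> < r} \<inter> {0<..} \<in> sets borel" by measurable
    then show "{a. 2 * \<bar>a - q\<bar> < r} \<inter> {0<..} \<in> sets (restrict_space borel {0<..})"
      by (simp add: sets_restrict_space_iff)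
  qed (use that V in \<open>auto simp: Q_def\<close>)
  ultimately show "scale_body -` U \<inter> space ?M \<in> sets ?M"
    by (auto intro!: sets.countable_UN')
qed


section \<open>The law of the thinness\<close>

text \<open>Thinness is scale invariant, so on the product it depends on the first factor only,
  whose marginal is \<open>N1\<close>; the law \<open>N\<close> of the size drops out. A weight that
  depends on the thinness alone passes to the image law by \<open>density_distr\<close>.\<close>

lemma distr_density_thinness:
  fixes N1 :: "'a::euclidean_space set measure"
  assumes N1: "prob_space N1" "sets N1 = sets (hausdorff_borel normalized_bodies)"
    and N: "prob_space N" "sets N = sets (restrict_space borel {0<..})"
    and [measurable]: "g \<in> borel_measurable borel"
  shows "distr (density (product_law N1 N) (\<lambda>K. g (thinness K))) borel thinness =
    density (distr N1 borel thinness) g"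
proof -
  have n: "(normalized_bodies :: 'a set set) \<subseteq> convex_bodies"
    using symmetric_convex_bodies by (auto simp: normalized_bodies_def)
  note [measurable_cong] = N1(2) N(2)
  note [measurable] = measurable_scale_body borel_measurable_thinness[OF n]
    borel_measurable_thinness[OF symmetric_convex_bodies]
  have sp: "space N1 = normalized_bodies" "space N = {0<..}"
    using sets_eq_imp_space_eq[OF N1(2)] sets_eq_imp_space_eq[OF N(2)]
    by (simp_all add: space_hausdorff_borel[OF n] space_restrict_space)
  have "distr (product_law N1 N) borel thinness = distr (N1 \<Otimes>\<^sub>M N) borel (thinness \<circ> scale_body)"
    unfolding product_law_def by (rule distr_distr) measurable
  also have "\<dots> = distr (N1 \<Otimes>\<^sub>M N) borel (thinness \<circ> fst)"
  proof (rule distr_cong)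
    fix p assume "p \<in> space (N1 \<Otimes>\<^sub>M N)"
    then obtain K a where "p = (K, a)" "K \<in> convex_bodies" "a > 0"
      using n by (auto simp: space_pair_measure sp)
    then show "(thinness \<circ> scale_body) p = (thinness \<circ> fst) p"
      using convex_bodiesD(2,4)[of K] thinness_scale_body[of K a] by simp
  qed simp_all
  also have "\<dots> = distr (distr (N1 \<Otimes>\<^sub>M N) N1 fst) borel thinness"
    by (rule distr_distr[symmetric]) measurable
  also have "\<dots> = distr N1 borel thinness"
    by (simp add: prob_space.distr_pair_fst[OF N(1)])
  finally have "distr (product_law N1 N) borel thinness = distr N1 borel thinness" .
  moreover have "thinness \<in> borel_measurable (product_law N1 N)"
    unfolding product_law_def by measurable
  ultimately show ?thesis by (metis density_distr assms(5))
qed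

section \<open>The standard normal law and the affine substitution\<close>

text \<open>The density is positive everywhere, so an interval of mass 0 would be Lebesgue null.
  Strictness makes the normalizing denominators positive.\<close>

lemma std_normal_cdf_less:
  assumes "x < y"
  shows "std_normal_cdf x < std_normal_cdf y"
proof -
  interpret real_distribution std_normal_distribution
    by (rule real_dist_normal_dist)
  have "emeasure std_normal_distribution {x<..y} \<noteq> 0"
  proof
    assume "emeasure std_normal_distribution {x<..y} = 0"
    then have "{x<..y} \<in> null_sets (density lborel std_normal_density)" by auto
    then have "AE z in lborel. z \<in> {x<..y} \<longrightarrow> ennreal (std_normal_density z) = 0"
      by (subst (asm) null_sets_density_iff) auto
    then have "AE z in lborel. z \<notin> {x<..y}"
      by (rule AE_mp) (auto intro!: AE_I2 simp: normal_density_pos less_imp_neq[symmetric])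
    then have "emeasure lborel {x<..y} = 0"
      by (subst (asm) AE_iff_measurable[of "{x<..y}"]) auto
    then show False using assms by simp
  qed
  then have "prob {x<..y} \<noteq> 0" by (simp add: emeasure_eq_measure)
  then show ?thesis
    using cdf_diff_eq[OF assms] measure_nonneg[of std_normal_distribution "{x<..y}"] by linarith
qed

text \<open>The law has no atoms, so end points do not matter and every interval reduces to the
  half-open one of \<open>cdf_diff_eq\<close>.\<close>

lemma measure_std_normal_interval:
  assumes "x \<le> y"
  shows "measure std_normal_distribution {x..y} = std_normal_cdf y - std_normal_cdf x"
    and "measure std_normal_distribution {x..<y} = std_normal_cdf y - std_normal_cdf x"
proof -
  interpret real_distribution std_normal_distribution
    by (rule real_dist_normal_dist)
  have ne: "AE z in std_normal_distribution. z \<noteq> a" for a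
    using AE_lborel_singleton[of a] by (simp add: AE_density) (elim eventually_mono, simp)
  have "AE z in std_normal_distribution. z \<in> {x..y} \<longleftrightarrow> z \<in> {x<..y}"
    using ne[of x] by eventually_elim auto
  then have "prob {x..y} = prob {x<..y}"
    by (rule finite_measure_eq_AE) auto
  moreover have "AE z in std_normal_distribution. z \<in> {x..<y} \<longleftrightarrow> z \<in> {x<..y}"
    using ne[of x] ne[of y] by eventually_elim auto
  then have "prob {x..<y} = prob {x<..y}"
    by (rule finite_measure_eq_AE) auto
  moreover have "prob {x<..y} = std_normal_cdf y - std_normal_cdf x"
    using cdf_diff_eq[of x y] assms by (cases "x = y") auto
  ultimately show "prob {x..y} = std_normal_cdf y - std_normal_cdf x"
    "prob {x..<y} = std_normal_cdf y - std_normal_cdf x" by simp_all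
qed

text \<open>This is the density in \<open>thinness_measure\<close> as a function of the thinness
  \<open>x\<close>, with the Hausdorff distance replaced by its value
  \<open>2 * x - 1\<close>.\<close>

definition normal_weight :: "real \<Rightarrow> real \<Rightarrow> real" where
  "normal_weight \<sigma> x = 4 / ((std_normal_cdf (1/\<sigma>) - std_normal_cdf 0) * sqrt (2 * pi * \<sigma>\<^sup>2)) *
     exp (- (2 * x - 1)\<^sup>2 / (2 * \<sigma>\<^sup>2))"

lemma emeasure_density_uniform_normal_weight:
  assumes \<sigma>: "\<sigma> > 0" and A [measurable]: "A \<in> sets borel" and sub: "A \<subseteq> {1/2..<1}"
  shows "emeasure (density (uniform_measure lborel {1/2..<1}) (\<lambda>x. ennreal (normal_weight \<sigma> x))) A =
    ennreal (4 / (std_normal_cdf (1/\<sigma>) - std_normal_cdf 0)) *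
    emeasure std_normal_distribution ((\<lambda>z. 1/2 + \<sigma>/2 * z) -` A)"
proof -
  define D where "D = std_normal_cdf (1/\<sigma>) - std_normal_cdf 0"
  have D: "D > 0" using std_normal_cdf_less[of 0 "1/\<sigma>"] \<sigma> by (simp add: D_def)
  have [measurable]: "normal_weight \<sigma> \<in> borel_measurable borel"
    unfolding normal_weight_def[abs_def] by measurable
  \<comment> \<open>The left side is the weight times the Jacobian \<sigma>/2. The substitution
    turns the exponent into that of the standard normal law and cancels the \<sigma> in the
    constant. The remaining factor 2/D doubles to 4/D when divided by the length 1/2 of the
    interval.\<close>
  have w: "\<sigma> * normal_weight \<sigma> (1/2 + \<sigma> * z / 2) / 2 = 2 * std_normal_density z / D" for z
  proof -
    have e: "- (2 * (1/2 + \<sigma> * z / 2) - 1)\<^sup>2 / (2 * \<sigma>\<^sup>2) = - z\<^sup>2 / 2"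
      using \<sigma> by (simp add: power_mult_distrib)
    show ?thesis
      unfolding normal_weight_def e D_def[symmetric]
      unfolding std_normal_density_def using \<sigma> by (simp add: real_sqrt_mult)
  qed
  have half: "emeasure lborel {1/2..<1::real} = ennreal (1/2)" by simp
  let ?B = "(\<lambda>z. 1/2 + \<sigma>/2 * z) -` A"
  have B [measurable]: "?B \<in> sets borel"
    using measurable_sets[of "\<lambda>z. 1/2 + \<sigma>/2 * z" borel borel A] by simp
  have "emeasure (density (uniform_measure lborel {1/2..<1}) (\<lambda>x. ennreal (normal_weight \<sigma> x))) A
      = (\<integral>\<^sup>+x. ennreal (normal_weight \<sigma> x) * indicator A x * indicator {1/2..<1} x \<partial>lborel) / ennreal (1/2)"
    by (simp add: emeasure_density nn_integral_uniform_measure half)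
  also have "(\<integral>\<^sup>+x. ennreal (normal_weight \<sigma> x) * indicator A x * indicator {1/2..<1} x \<partial>lborel)
      = (\<integral>\<^sup>+x. ennreal (normal_weight \<sigma> x) * indicator A x \<partial>lborel)"
    using sub by (intro nn_integral_cong) (auto simp: indicator_def)
  also have "\<dots> = ennreal \<bar>\<sigma> / 2\<bar> *
      (\<integral>\<^sup>+z. ennreal (normal_weight \<sigma> (1/2 + \<sigma>/2 * z)) * indicator A (1/2 + \<sigma>/2 * z) \<partial>lborel)"
    using \<sigma> by (intro nn_integral_real_affine) auto
  also have "\<dots> = (\<integral>\<^sup>+z. ennreal (2 / D) * (ennreal (std_normal_density z) * indicator ?B z) \<partial>lborel)"
    using \<sigma> D
    by (subst nn_integral_cmult[symmetric])
      (auto intro!: nn_integral_cong simp: w indicator_def simp flip: ennreal_mult')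
  also have "\<dots> = ennreal (2 / D) * emeasure std_normal_distribution ?B"
    using B by (subst nn_integral_cmult) (simp_all add: emeasure_density)
  also have "\<dots> / ennreal (1/2) =
      ennreal 2 * (ennreal (2 / D) * emeasure std_normal_distribution ?B)"
    by (subst divide_ennreal_def, subst inverse_ennreal) (simp_all add: mult.commute)
  also have "\<dots> = ennreal (4 / D) * emeasure std_normal_distribution ?B"
    using D by (simp flip: mult.assoc ennreal_mult' ennreal_numeral)
  finally show ?thesis by (simp only: D_def)
qed

section \<open>The pullback measure\<close>

text \<open>On sets of the form \<open>symmetrization -` H\<close> the image under the symmetrization is the trace on
  the symmetric bodies, so the pullback is the image of \<open>P\<close> under the inclusion.\<close>

lemma pullback_measure_eq_distr:
  fixes P :: "'a::euclidean_space set measure"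
  assumes "space P = symmetric_bodies"
  shows "pullback_measure P = distr P (vimage_algebra convex_bodies symmetrization P) (\<lambda>K. K)"
proof -
  let ?V = "vimage_algebra convex_bodies symmetrization P"
  have sets: "sets ?V = {symmetrization -` H \<inter> convex_bodies | H. H \<in> sets P}"
    using assms by (intro sets_vimage_algebra2) (auto intro: symmetrization_symmetric)
  \<comment> \<open>\<open>measure_of\<close> returns the zero measure for a set function that is
    not countably additive. Rewriting images as preimages under the inclusion gives the set function
    by which \<open>distr\<close> is defined.\<close>
  have "measure_of convex_bodies (sets ?V) (\<lambda>H. emeasure P (symmetrization ` H)) =
    measure_of convex_bodies (sets ?V) (\<lambda>H. emeasure P ((\<lambda>K. K) -` H \<inter> space P))"
  proof (rule measure_of_eq)
    show "sets ?V \<subseteq> Pow convex_bodies"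
      using sets.space_closed[of ?V] by simp
    fix H assume "H \<in> sigma_sets convex_bodies (sets ?V)"
    then have "H \<in> sets ?V" using sets.sigma_sets_eq[of ?V] by simp
    then obtain H' where H: "H = symmetrization -` H' \<inter> convex_bodies" "H' \<in> sets P"
      by (auto simp: sets)
    have sub: "H' \<subseteq> symmetric_bodies" using sets.sets_into_space[OF H(2)] assms by simp
    have H': "K \<in> convex_bodies" "symmetrization K = K" if "K \<in> H'" for K
      using subsetD[OF symmetric_convex_bodies subsetD[OF sub that]]
        symmetrization_symmetric_body[OF subsetD[OF sub that]] by simp_all
    have "symmetrization ` H = H'"
    proof (intro equalityI subsetI)
      fix K assume "K \<in> H'"
      then show "K \<in> symmetrization ` H"
        using H' by (intro image_eqI[of _ _ K]) (auto simp: H(1))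
    qed (auto simp: H(1))
    moreover have "H \<inter> symmetric_bodies = H'"
      using H' sub by (auto simp: H(1) symmetrization_symmetric_body)
    ultimately show "emeasure P (symmetrization ` H) = emeasure P ((\<lambda>K. K) -` H \<inter> space P)"
      using assms by simp
  qed
  then show ?thesis
    by (simp add: pullback_measure_def distr_def flip: sets)
qed

context
  fixes P :: "'a::euclidean_space set measure"
  assumes sets_P: "sets P = sets (hausdorff_borel symmetric_bodies)"
begin

lemma space_symmetric_bodies_measure: "space P = symmetric_bodies"
  using sets_eq_imp_space_eq[OF sets_P] space_hausdorff_borel[OF symmetric_convex_bodies] by simp

lemma space_pullback_measure: "space (pullback_measure P) = convex_bodies"
  by (simp add: pullback_measure_eq_distr[OF space_symmetric_bodies_measure])

lemma sets_pullback_measure: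
  "sets (pullback_measure P) = {symmetrization -` H \<inter> convex_bodies | H.
     H \<in> sets (hausdorff_borel symmetric_bodies)}"
  unfolding pullback_measure_eq_distr[OF space_symmetric_bodies_measure] sets_distr
  using space_symmetric_bodies_measure
  by (subst sets_vimage_algebra2) (auto intro: symmetrization_symmetric simp: sets_P)

text \<open>A map into the vimage algebra is measurable once its composition with
  \<open>symmetrization\<close> is, and on symmetric bodies that composition is the
  identity.\<close>

lemma measurable_inclusion:
  "(\<lambda>K. K) \<in> P \<rightarrow>\<^sub>M vimage_algebra convex_bodies symmetrization P"
proof (rule measurable_vimage_algebra2)
  show "(\<lambda>K. symmetrization K) \<in> P \<rightarrow>\<^sub>M P"
    using measurable_ident_sets[OF refl, of P]
    by (subst measurable_cong[where g = "\<lambda>K. K"])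
      (auto simp: space_symmetric_bodies_measure symmetrization_symmetric_body)
qed (use symmetric_convex_bodies in \<open>auto simp: space_symmetric_bodies_measure\<close>)

lemma image_symmetrization_pullback_sets:
  assumes "H \<in> sets (pullback_measure P)"
  shows "symmetrization ` H = H \<inter> symmetric_bodies"
proof -
  obtain H' where H': "H = symmetrization -` H' \<inter> convex_bodies"
    using assms by (auto simp: sets_pullback_measure)
  have "K \<in> symmetrization ` H" if "K \<in> H \<inter> symmetric_bodies" for K
    using that symmetrization_symmetric_body by (metis IntD1 IntD2 image_eqI)
  moreover have "symmetrization K \<in> H \<inter> symmetric_bodies" if "K \<in> H" for K
    using that symmetrization_symmetric[of K] symmetric_convex_bodies
      symmetrization_symmetric_body[of "symmetrization K"] by (auto simp: H')
  ultimately show ?thesis by blast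
qed

lemma emeasure_pullback_measure:
  assumes "H \<in> sets (pullback_measure P)"
  shows "emeasure (pullback_measure P) H = emeasure P (symmetrization ` H)"
  using assms
  by (simp add: image_symmetrization_pullback_sets[OF assms] emeasure_distr[OF measurable_inclusion]
      pullback_measure_eq_distr[OF space_symmetric_bodies_measure] space_symmetric_bodies_measure)

text \<open>A function measurable for the sigma-algebra of preimages must factor through
  \<open>symmetrization\<close>; thinness does so by invariance.\<close>

lemma borel_measurable_thinness_pullback: "thinness \<in> borel_measurable (pullback_measure P)"
proof -
  have "symmetrization \<in> vimage_algebra convex_bodies symmetrization P \<rightarrow>\<^sub>M P"
    by (rule measurable_vimage_algebra1)
      (auto intro: symmetrization_symmetric simp: space_symmetric_bodies_measure)
  moreover have "thinness \<in> borel_measurable P"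
    using borel_measurable_thinness[OF symmetric_convex_bodies] sets_P
    by (simp cong: measurable_cong_sets)
  ultimately have "(\<lambda>K. thinness (symmetrization K)) \<in>
      borel_measurable (vimage_algebra convex_bodies symmetrization P)"
    by (rule measurable_compose)
  then have "thinness \<in> borel_measurable (vimage_algebra convex_bodies symmetrization P)"
    by (subst measurable_cong[where g = "\<lambda>K. thinness (symmetrization K)"])
      (auto simp: thinness_symmetrization)
  then show ?thesis
    by (simp add: pullback_measure_eq_distr[OF space_symmetric_bodies_measure])
qed

text \<open>Continuity of \<open>symmetrization\<close> makes the preimages of Borel sets
  Borel.\<close>

lemma sets_pullback_measure_subset:
  "sets (pullback_measure P) \<subseteq> sets (hausdorff_borel convex_bodies)"
  using measurable_sets[OF measurable_hausdorff_continuous[OF order_refl symmetric_convex_bodies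
      continuous_map_symmetrization]]
  by (auto simp: sets_pullback_measure space_hausdorff_borel)

lemma distr_thinness_pullback: "distr (pullback_measure P) borel thinness = distr P borel thinness"
  using borel_measurable_thinness_pullback measurable_inclusion
  by (simp add: pullback_measure_eq_distr[OF space_symmetric_bodies_measure] distr_distr comp_def)

end

section \<open>The law of the thinness under the pullback of \<open>P\<close>\<close>

lemma thinness_measure_eq_density:
  "thinness_measure \<sigma> N1 N =
    density (product_law N1 N) (\<lambda>K. ennreal (normal_weight \<sigma> (thinness K)))"
proof -
  have "space (product_law N1 N) = symmetric_bodies"
    by (simp add: product_law_def space_hausdorff_borel[OF symmetric_convex_bodies])
  \<comment> \<open>The formula for the distance is available for symmetric bodies only, so the
    densities are compared under the integral and not as functions.\<close>
  then have "(\<integral>\<^sup>+K. ennreal (4 / ((std_normal_cdf (1/\<sigma>) - std_normal_cdf 0) * sqrt (2 * pi * \<sigma>\<^sup>2)) *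
      exp (- (hausdorff_dist (cball 0 1) (scale_body (K, thinness K / scale_factor K)))\<^sup>2
             / (2 * \<sigma>\<^sup>2))) * indicator A K \<partial>product_law N1 N) =
    (\<integral>\<^sup>+K. ennreal (normal_weight \<sigma> (thinness K)) * indicator A K \<partial>product_law N1 N)" for A
    by (intro nn_integral_cong) (simp only: hausdorff_dist_unit_ball_thinness normal_weight_def)
  then show ?thesis
    unfolding thinness_measure_def density_def by (simp only:)
qed

lemma sets_thinness_measure:
  "sets (thinness_measure \<sigma> N1 N) = sets (hausdorff_borel symmetric_bodies)"
  by (simp add: thinness_measure_def product_law_def)

lemma thinness_vimage_convex_bodies: "thinness -` {1/2..<1} \<inter> convex_bodies = convex_bodies"
  by (intro Int_absorb1 subsetI vimageI2 thinness_bounds)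

context
  fixes \<sigma> :: real and N1 :: "'a::euclidean_space set measure" and N :: "real measure"
  assumes \<sigma>: "\<sigma> > 0"
    and N1: "prob_space N1" "sets N1 = sets (hausdorff_borel normalized_bodies)"
    and unif: "distr N1 borel thinness = uniform_measure lborel {1/2..<1}"
    and N: "prob_space N" "sets N = sets (restrict_space borel {0<..})"
begin

private abbreviation "\<mu> \<equiv> pullback_measure (thinness_measure \<sigma> N1 N)"

lemma emeasure_pullback_thinness:
  assumes A: "A \<in> sets borel" "A \<subseteq> {1/2..<1}"
  shows "emeasure \<mu> (thinness -` A \<inter> convex_bodies) =
    ennreal (4 * measure std_normal_distribution ((\<lambda>z. 1/2 + \<sigma>/2 * z) -` A) /
      (std_normal_cdf (1/\<sigma>) - std_normal_cdf 0))"
proof -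
  interpret S: real_distribution std_normal_distribution by (rule real_dist_normal_dist)
  note th = borel_measurable_thinness_pullback[OF sets_thinness_measure, of \<sigma> N1 N]
  have D: "std_normal_cdf (1/\<sigma>) - std_normal_cdf 0 > 0"
    using std_normal_cdf_less[of 0 "1/\<sigma>"] \<sigma> by simp
  have "normal_weight \<sigma> \<in> borel_measurable borel"
    unfolding normal_weight_def[abs_def] by measurable
  then have "distr (thinness_measure \<sigma> N1 N) borel thinness =
      density (uniform_measure lborel {1/2..<1}) (\<lambda>x. ennreal (normal_weight \<sigma> x))"
    using distr_density_thinness[OF N1 N, of "\<lambda>x. ennreal (normal_weight \<sigma> x)"]
    by (simp add: unif thinness_measure_eq_density)
  then have "emeasure (distr \<mu> borel thinness) A =
      ennreal (4 / (std_normal_cdf (1/\<sigma>) - std_normal_cdf 0)) *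
      emeasure std_normal_distribution ((\<lambda>z. 1/2 + \<sigma>/2 * z) -` A)"
    by (simp only: distr_thinness_pullback[OF sets_thinness_measure]
        emeasure_density_uniform_normal_weight[OF \<sigma> A])
  moreover have "emeasure (distr \<mu> borel thinness) A = emeasure \<mu> (thinness -` A \<inter> convex_bodies)"
    by (simp add: emeasure_distr[OF th A(1)] space_pullback_measure[OF sets_thinness_measure])
  ultimately show ?thesis
    using D by (simp add: S.emeasure_eq_measure flip: ennreal_mult'')
qed

text \<open>All thinness values lie in [1/2, 1), which the substitution turns into [0, 1/\<sigma>).
  The normal mass of that interval is the denominator, which leaves the factor 4.\<close>

lemma emeasure_pullback_thinness_total: "emeasure \<mu> convex_bodies = 4"
proof -
  have "(\<lambda>z. 1/2 + \<sigma>/2 * z) -` {1/2..<1} = {0..<1/\<sigma>}"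
    using \<sigma> by (auto simp: field_simps zero_le_mult_iff)
  then show ?thesis
    using emeasure_pullback_thinness[of "{1/2..<1}"] std_normal_cdf_less[of 0 "1/\<sigma>"] \<sigma>
      measure_std_normal_interval(2)[of 0 "1/\<sigma>"]
    by (simp add: thinness_vimage_convex_bodies del: right_diff_distrib_numeral)
qed

text \<open>The substitution turns [1/2, c] into the interval from 0 to (c - 1/2)/(\<sigma>/2), and
  dividing by the total mass cancels the factor 4.\<close>

lemma truncated_normal_pullback: "truncated_normal \<sigma> (distr (normalize_measure \<mu>) borel thinness)"
proof -
  note th = borel_measurable_thinness_pullback[OF sets_thinness_measure, of \<sigma> N1 N]
  note sp = space_pullback_measure[OF sets_thinness_measure, of \<sigma> N1 N]
  define D where "D = distr (normalize_measure \<mu>) borel thinness"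
  have "thinness \<in> borel_measurable (normalize_measure \<mu>)"
    using th by (simp add: normalize_measure_def)
  then have D: "emeasure D A = emeasure \<mu> (thinness -` A \<inter> convex_bodies) / 4"
    if "A \<in> sets borel" for A
    using that
    by (simp add: D_def emeasure_distr)
      (simp add: normalize_measure_def space_scale_measure sp emeasure_pullback_thinness_total
        divide_ennreal_def mult.commute)
  have total: "emeasure D {1/2..<1} = 1" "emeasure D UNIV = 1"
    by (simp_all add: D thinness_vimage_convex_bodies emeasure_pullback_thinness_total)
  show ?thesis
    unfolding truncated_normal_def D_def[symmetric]
  proof (intro conjI ballI)
    show "prob_space D" using total(2) by (auto intro!: prob_spaceI simp: D_def)
    show "measure D {1/2..<1} = 1" by (simp add: measure_def total)
    show "sets D = sets borel" by (simp add: D_def)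
    fix c :: real assume c: "c \<in> {1/2..<1}"
    have "(\<lambda>z. 1/2 + \<sigma>/2 * z) -` {1/2..c} = {0..(c - 1/2) / (\<sigma>/2)}"
      using \<sigma> by (auto simp: field_simps zero_le_mult_iff)
    moreover have "0 \<le> (c - 1/2) / (\<sigma>/2)" using c \<sigma> by simp
    moreover have "{1/2..c} \<subseteq> {1/2..<1}" using c by auto
    ultimately have "emeasure D {1/2..c} =
        ennreal (4 * (std_normal_cdf ((c - 1/2) / (\<sigma>/2)) - std_normal_cdf 0) /
          (std_normal_cdf (1/\<sigma>) - std_normal_cdf 0)) / ennreal 4"
      using emeasure_pullback_thinness[of "{1/2..c}"]
      by (simp add: D measure_std_normal_interval(1))
    moreover have "0 \<le> std_normal_cdf ((c - 1/2) / (\<sigma>/2)) - std_normal_cdf 0"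
      using measure_std_normal_interval(1)[OF \<open>0 \<le> (c - 1/2) / (\<sigma>/2)\<close>]
        measure_nonneg[of std_normal_distribution "{0..(c - 1/2) / (\<sigma>/2)}"] by linarith
    moreover have "0 < std_normal_cdf (1/\<sigma>) - std_normal_cdf 0"
      using std_normal_cdf_less[of 0 "1/\<sigma>"] \<sigma> by simp
    moreover have "ennreal (4 * x / y) / ennreal 4 = ennreal (x / y)"
      if "0 \<le> x" "0 < y" for x y :: real
      using that by (subst divide_ennreal) auto
    ultimately show "measure D {1/2..c} =
        (std_normal_cdf ((c - 1/2) / (\<sigma>/2)) - std_normal_cdf 0) /
        (std_normal_cdf (1/\<sigma>) - std_normal_cdf 0)"
      by (simp only: measure_def enn2real_ennreal divide_nonneg_pos)
  qed
qed

end

lemma vimage_thinness_sets_pullback: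
  assumes "sets P = sets (hausdorff_borel symmetric_bodies)" "B \<in> sets borel"
  shows "thinness -` B \<inter> convex_bodies \<in> sets (pullback_measure P)"
  using measurable_sets[OF borel_measurable_thinness_pullback[OF assms(1)] assms(2)]
  by (simp add: space_pullback_measure[OF assms(1)])

theorem corollary1:
  shows
    "continuous_map (hausdorff_topology convex_bodies) (hausdorff_topology symmetric_bodies)
       (symmetrization :: 'a::euclidean_space set \<Rightarrow> 'a set) \<and>
     symmetrization ` (convex_bodies :: 'a set set) = symmetric_bodies \<and>
     (\<forall>S \<subseteq> (convex_bodies :: 'a set set). \<forall>t.
        symmetrization ` ((\<lambda>K. translate K t) ` S) = symmetrization ` S) \<and>
     (\<forall>K \<in> (convex_bodies :: 'a set set).
        diameter K = diameter (symmetrization K) \<and>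
        width K = width (symmetrization K) \<and>
        thinness K = thinness (symmetrization K)) \<and>
     (\<forall>K \<in> (convex_bodies :: 'a set set). thinness K \<in> {1/2..<1}) \<and>
     (\<forall>(\<sigma> :: real) (N1 :: 'a set measure) (N :: real measure).
        \<sigma> > 0 \<and>
        prob_space N1 \<and> sets N1 = sets (hausdorff_borel normalized_bodies) \<and>
        distr N1 borel thinness = uniform_measure lborel {1/2..<1} \<and>
        prob_space N \<and> sets N = sets (restrict_space borel {0<..}) \<longrightarrow>
        (let P = thinness_measure \<sigma> N1 N; \<mu> = pullback_measure P in
           space \<mu> = convex_bodies \<and>
           sets \<mu> = {symmetrization -` H' \<inter> convex_bodies | H'.
                      H' \<in> sets (hausdorff_borel symmetric_bodies)} \<and>
           sets \<mu> \<subseteq> sets (hausdorff_borel convex_bodies) \<and>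
           (\<forall>H \<in> sets \<mu>. emeasure \<mu> H = emeasure P (symmetrization ` H)) \<and>
           thinness \<in> borel_measurable \<mu> \<and>
           (\<forall>B \<in> sets borel. B \<subseteq> {1/2..<1} \<longrightarrow>
              emeasure \<mu> (thinness -` B \<inter> convex_bodies) =
                emeasure P (symmetrization ` (thinness -` B \<inter> convex_bodies)) \<and>
              emeasure P (symmetrization ` (thinness -` B \<inter> convex_bodies)) =
                emeasure P (thinness -` B \<inter> symmetric_bodies)) \<and>
           emeasure \<mu> (space \<mu>) = 4 \<and>
           truncated_normal \<sigma> (distr (normalize_measure \<mu>) borel thinness)))"
  unfolding Let_def
proof (intro conjI allI impI ballI; (elim conjE)?)
  fix \<sigma> :: real and N1 :: "'a set measure" and N :: "real measure" and B :: "real set"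
  let ?P = "thinness_measure \<sigma> N1 N"
  assume B: "B \<in> sets borel"
  have H: "thinness -` B \<inter> convex_bodies \<in> sets (pullback_measure ?P)"
    by (rule vimage_thinness_sets_pullback[OF sets_thinness_measure B])
  show "emeasure (pullback_measure ?P) (thinness -` B \<inter> convex_bodies) =
      emeasure ?P (symmetrization ` (thinness -` B \<inter> convex_bodies))"
    by (rule emeasure_pullback_measure[OF sets_thinness_measure H])
  have "thinness -` B \<inter> convex_bodies \<inter> symmetric_bodies =
      thinness -` B \<inter> (symmetric_bodies :: 'a set set)"
    using symmetric_convex_bodies by auto
  then show "emeasure ?P (symmetrization ` (thinness -` B \<inter> convex_bodies)) =
      emeasure ?P (thinness -` B \<inter> symmetric_bodies)"
    by (simp add: image_symmetrization_pullback_sets[OF sets_thinness_measure H])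
next
  fix K :: "'a set" assume "K \<in> convex_bodies"
  then show "thinness K \<in> {1/2..<1}" by (rule thinness_bounds)
next
  fix \<sigma> :: real and N1 :: "'a set measure" and N :: "real measure"
  let ?\<mu> = "pullback_measure (thinness_measure \<sigma> N1 N)"
  assume a: "\<sigma> > 0" "prob_space N1" "sets N1 = sets (hausdorff_borel normalized_bodies)"
    "distr N1 borel thinness = uniform_measure lborel {1/2..<1}"
    "prob_space N" "sets N = sets (restrict_space borel {0<..})"
  show "sets ?\<mu> \<subseteq> sets (hausdorff_borel convex_bodies)"
    by (rule sets_pullback_measure_subset[OF sets_thinness_measure])
  show "emeasure ?\<mu> (space ?\<mu>) = 4"
    using emeasure_pullback_thinness_total[OF a]
    by (simp add: space_pullback_measure[OF sets_thinness_measure])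
  show "truncated_normal \<sigma> (distr (normalize_measure ?\<mu>) borel thinness)"
    by (rule truncated_normal_pullback[OF a])
qed (simp_all add: image_image continuous_map_symmetrization symmetrization_surj
    symmetrization_translate diameter_symmetrization width_symmetrization thinness_symmetrization
    space_pullback_measure[OF sets_thinness_measure]
    sets_pullback_measure[OF sets_thinness_measure]
    emeasure_pullback_measure[OF sets_thinness_measure]
    borel_measurable_thinness_pullback[OF sets_thinness_measure])

end
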